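(* Let $M$ be a manifold-with-boundary equipped with a free circle action near its boundary, and let $M_{\mathrm{red}}=(\partial M)/S^1$. Let $\beta$ be a contact one-form on $M$ that is basic on $\partial M$ and invariant near $\partial M$. Then $\beta_{\mathrm{red}}$ is a contact one-form on $M_{\mathrm{red}}$.
   Context: Manifolds, with or without boundary, are smooth, Hausdorff and second countable. "A free circle action near the boundary" means a smooth free action of $S^1$ on an open neighbourhood $U_M$ of the boundary $\partial M$ in $M$; necessarily $\partial M$ is $S^1$-invariant. $M_{\mathrm{red}} := (\partial M)/S^1$ has the unique manifold structure for which $\partial M\to M_{\mathrm{red}}$ is a principal $S^1$-bundle. "$\beta$ is basic on $\partial M$ and invariant near $\partial M$" means: the pullback of $\beta$ to $\partial M$ is $S^1$-basic (i.e. $S^1$-invariant and annihilated by contraction with the vector field generating the circle action), and the restriction of $\beta$ to some $S^1$-invariant neighbourhood of $\partial M$ in $U_M$ is $S^1$-invariant. For such $\beta$, $\beta_{\mathrm{red}}$ is the unique differential form on $M_{\mathrm{red}}$ whose pullback to $\partial M$ under the quotient map coincides with the pullback of $\beta$ to $\partial M$. A contact one-form on a $(2n+1)$-dimensional manifold is a one-form $\beta$ with $\beta\wedge(d\beta)^n$ nowhere vanishing. *)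

theory Defs
  imports "HOL-Analysis.Analysis"
begin

section \<open>Smooth maps between subsets of Euclidean spaces\<close>

primrec C_k_on :: "nat \<Rightarrow> 'a::euclidean_space set \<Rightarrow> ('a \<Rightarrow> 'b::euclidean_space) \<Rightarrow> bool" where
  "C_k_on 0 S f \<longleftrightarrow> continuous_on S f"
| "C_k_on (Suc k) S f \<longleftrightarrow>
     (\<forall>x\<in>S. f differentiable (at x)) \<and> (\<forall>v. C_k_on k S (\<lambda>x. frechet_derivative f (at x) v))"

text \<open>
  Smoothness on an arbitrary set means local extendability to a smooth map on an open set.
  On open sets this is ordinary smoothness; on relatively open subsets of a half-space, of a
  hyperplane or of the unit circle it is the usual notion for manifolds with boundary and
  embedded submanifolds.
\<close>

definition smooth_on :: "'a::euclidean_space set \<Rightarrow> ('a \<Rightarrow> 'b::euclidean_space) \<Rightarrow> bool" where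
  "smooth_on S f \<longleftrightarrow>
     (\<forall>x\<in>S. \<exists>W g. open W \<and> x \<in> W \<and> (\<forall>k. C_k_on k W g) \<and> (\<forall>y\<in>S \<inter> W. g y = f y))"


section \<open>Manifolds with or without boundary\<close>

text \<open>
  A chart is a pair of its domain and its coordinate map; values of the coordinate map outside
  the domain are irrelevant. An atlas need not be maximal.
\<close>

type_synonym ('p, 'm) chart = "'p set \<times> ('p \<Rightarrow> 'm)"

record ('p, 'm) mfld =
  mspace :: "'p topology"
  atlas :: "('p, 'm) chart set"

abbreviation points :: "('p, 'm) mfld \<Rightarrow> 'p set" where
  "points M \<equiv> topspace (mspace M)"

definition smooth_atlas :: "'m::euclidean_space set \<Rightarrow> ('p, 'm) mfld \<Rightarrow> bool" where
  "smooth_atlas H M \<longleftrightarrow>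
     (\<forall>(U, \<phi>)\<in>atlas M. openin (mspace M) U \<and> openin (top_of_set H) (\<phi> ` U) \<and>
        homeomorphic_map (subtopology (mspace M) U) (top_of_set (\<phi> ` U)) \<phi>) \<and>
     (\<Union>(U, \<phi>)\<in>atlas M. U) = points M \<and>
     (\<forall>(U, \<phi>)\<in>atlas M. \<forall>(V, \<psi>)\<in>atlas M. smooth_on (\<phi> ` (U \<inter> V)) (\<psi> \<circ> inv_into U \<phi>))"

definition normal_dir :: "'m::euclidean_space" where
  "normal_dir = (SOME e. e \<in> Basis)"

definition half_space :: "'m::euclidean_space set" where
  "half_space = {x. 0 \<le> x \<bullet> normal_dir}"

definition bdry_hyperplane :: "'m::euclidean_space set" where
  "bdry_hyperplane = {x. x \<bullet> normal_dir = 0}"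

definition manifold :: "('p, 'm::euclidean_space) mfld \<Rightarrow> bool" where
  "manifold M \<longleftrightarrow>
     Hausdorff_space (mspace M) \<and> second_countable (mspace M) \<and> smooth_atlas UNIV M"

definition manifold_with_boundary :: "('p, 'm::euclidean_space) mfld \<Rightarrow> bool" where
  "manifold_with_boundary M \<longleftrightarrow>
     Hausdorff_space (mspace M) \<and> second_countable (mspace M) \<and> smooth_atlas half_space M"

text \<open>
  The empty manifold counts as a manifold of every dimension.
\<close>

definition has_dim :: "('p, 'm::euclidean_space) mfld \<Rightarrow> nat \<Rightarrow> bool" where
  "has_dim M d \<longleftrightarrow> (points M \<noteq> {} \<longrightarrow> DIM('m) = d)"

text \<open>
  Restriction of the charts to a subset. It is used for open subsets and for the boundary,
  whose charts then take values in the hyperplane bounding the half-space.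
\<close>

definition submfld :: "('p, 'm) mfld \<Rightarrow> 'p set \<Rightarrow> ('p, 'm) mfld" where
  "submfld M A = \<lparr> mspace = subtopology (mspace M) A, atlas = (\<lambda>(U, \<phi>). (U \<inter> A, \<phi>)) ` atlas M \<rparr>"

definition bdry_points :: "('p, 'm::euclidean_space) mfld \<Rightarrow> 'p set" where
  "bdry_points M = {p. \<exists>(U, \<phi>)\<in>atlas M. p \<in> U \<and> \<phi> p \<in> bdry_hyperplane}"

definition bdry :: "('p, 'm::euclidean_space) mfld \<Rightarrow> ('p, 'm) mfld" where
  "bdry M = submfld M (bdry_points M)"

definition prod_mfld :: "('p, 'm) mfld \<Rightarrow> ('q, 'k) mfld \<Rightarrow> ('p \<times> 'q, 'm \<times> 'k) mfld" where
  "prod_mfld M N =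
     \<lparr> mspace = prod_topology (mspace M) (mspace N),
       atlas = {(U \<times> V, map_prod \<phi> \<psi>) |U \<phi> V \<psi>. (U, \<phi>) \<in> atlas M \<and> (V, \<psi>) \<in> atlas N} \<rparr>"

abbreviation circle :: "complex set" where
  "circle \<equiv> sphere 0 1"

text \<open>
  The circle carries the inclusion into the plane as its only chart, which describes its
  smooth structure as an embedded submanifold (see the remark on smooth_on).
\<close>

definition circle_mfld :: "(complex, complex) mfld" where
  "circle_mfld = \<lparr> mspace = top_of_set circle, atlas = {(circle, id)} \<rparr>"

definition smooth_map ::
  "('p, 'm::euclidean_space) mfld \<Rightarrow> ('q, 'k::euclidean_space) mfld \<Rightarrow> ('p \<Rightarrow> 'q) \<Rightarrow> bool" where
  "smooth_map M N f \<longleftrightarrow>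
     continuous_map (mspace M) (mspace N) f \<and>
     (\<forall>(U, \<phi>)\<in>atlas M. \<forall>(V, \<psi>)\<in>atlas N. smooth_on (\<phi> ` (U \<inter> f -` V)) (\<psi> \<circ> f \<circ> inv_into U \<phi>))"

definition diffeo ::
  "('p, 'm::euclidean_space) mfld \<Rightarrow> ('q, 'k::euclidean_space) mfld \<Rightarrow> ('p \<Rightarrow> 'q) \<Rightarrow> bool" where
  "diffeo M N f \<longleftrightarrow>
     smooth_map M N f \<and>
     (\<exists>g. smooth_map N M g \<and> (\<forall>p\<in>points M. g (f p) = p) \<and> (\<forall>q\<in>points N. f (g q) = q))"


section \<open>Differential forms\<close>

text \<open>
  Alternating k-forms on a vector space are functions of sequences of vectors of which only
  the entries with index below k matter.
\<close>

definition wedge ::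
  "nat \<Rightarrow> nat \<Rightarrow> ((nat \<Rightarrow> 'm) \<Rightarrow> real) \<Rightarrow> ((nat \<Rightarrow> 'm) \<Rightarrow> real) \<Rightarrow> (nat \<Rightarrow> 'm) \<Rightarrow> real" where
  "wedge k l a b v =
     (\<Sum>\<sigma> | \<sigma> permutes {..<k + l}.
        of_int (sign \<sigma>) * a (\<lambda>i. v (\<sigma> i)) * b (\<lambda>i. v (\<sigma> (k + i)))) / (fact k * fact l)"

primrec wedge_power :: "((nat \<Rightarrow> 'm) \<Rightarrow> real) \<Rightarrow> nat \<Rightarrow> (nat \<Rightarrow> 'm) \<Rightarrow> real"
  \<comment> \<open>powers of a 2-form\<close>
  where
    "wedge_power w 0 = (\<lambda>v. 1)"
  | "wedge_power w (Suc k) = wedge 2 (2 * k) w (wedge_power w k)"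

text \<open>
  A one-form is given by its local representatives: to a chart with coordinate map
  \<open>\<phi>\<close>, a point x of its image and a vector v of the model space it assigns the value at
  the tangent vector at the inverse image of x whose coordinates are v. The representatives are
  related by the transition maps.
\<close>

type_synonym ('p, 'm) form1 = "('p, 'm) chart \<Rightarrow> 'm \<Rightarrow> 'm \<Rightarrow> real"

definition one_form :: "('p, 'm::euclidean_space) mfld \<Rightarrow> ('p, 'm) form1 \<Rightarrow> bool" where
  "one_form M \<beta> \<longleftrightarrow>
     (\<forall>(U, \<phi>)\<in>atlas M.
        (\<forall>x\<in>\<phi> ` U. linear (\<beta> (U, \<phi>) x)) \<and>
        (\<forall>v. smooth_on (\<phi> ` U) (\<lambda>x. \<beta> (U, \<phi>) x v)) \<and>
        (\<forall>(V, \<psi>)\<in>atlas M. \<forall>p\<in>U \<inter> V. \<forall>v.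
           \<beta> (U, \<phi>) (\<phi> p) v =
           \<beta> (V, \<psi>) (\<psi> p)
             (frechet_derivative (\<psi> \<circ> inv_into U \<phi>) (at (\<phi> p) within \<phi> ` (U \<inter> V)) v)))"

definition ext_deriv :: "('p, 'm::euclidean_space) form1 \<Rightarrow> ('p, 'm) chart \<Rightarrow> 'm \<Rightarrow> (nat \<Rightarrow> 'm) \<Rightarrow> real"
  where
  "ext_deriv \<beta> = (\<lambda>(U, \<phi>) x v.
     frechet_derivative (\<lambda>y. \<beta> (U, \<phi>) y (v 1)) (at x within \<phi> ` U) (v 0) -
     frechet_derivative (\<lambda>y. \<beta> (U, \<phi>) y (v 0)) (at x within \<phi> ` U) (v 1))"

definition contact_one_form :: "nat \<Rightarrow> ('p, 'm::euclidean_space) mfld \<Rightarrow> ('p, 'm) form1 \<Rightarrow> bool" where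
  "contact_one_form n M \<beta> \<longleftrightarrow>
     has_dim M (2 * n + 1) \<and> one_form M \<beta> \<and>
     (\<forall>(U, \<phi>)\<in>atlas M. \<forall>x\<in>\<phi> ` U.
        wedge 1 (2 * n) (\<lambda>v. \<beta> (U, \<phi>) x (v 0)) (wedge_power (ext_deriv \<beta> (U, \<phi>) x) n) \<noteq> (\<lambda>v. 0))"

text \<open>
  Pullback of a one-form \<open>\<gamma>\<close> on N along a smooth map f. The chart of N used around f p is
  arbitrary; the compatibility of the local representatives of \<open>\<gamma>\<close> makes the choice
  irrelevant. When the source is a boundary, only vectors v in the bounding hyperplane represent
  tangent vectors, and the derivative is determined on those only.
\<close>

definition pullback ::
  "('q, 'k::euclidean_space) mfld \<Rightarrow> ('p \<Rightarrow> 'q) \<Rightarrow> ('q, 'k) form1 \<Rightarrow> ('p, 'm::euclidean_space) form1"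
  where
  "pullback N f \<gamma> = (\<lambda>(U, \<phi>) x v.
     let p = inv_into U \<phi> x;
         (V, \<psi>) = (SOME c. c \<in> atlas N \<and> f p \<in> fst c)
     in \<gamma> (V, \<psi>) (\<psi> (f p))
          (frechet_derivative (\<psi> \<circ> f \<circ> inv_into U \<phi>) (at x within \<phi> ` (U \<inter> f -` V)) v))"

text \<open>
  Equality of one-forms on M, where T is the space of coordinate vectors of tangent vectors.
\<close>

definition forms_agree ::
  "'m set \<Rightarrow> ('p, 'm) mfld \<Rightarrow> ('p, 'm) form1 \<Rightarrow> ('p, 'm) form1 \<Rightarrow> bool" where
  "forms_agree T M \<alpha> \<beta> \<longleftrightarrow>
     (\<forall>(U, \<phi>)\<in>atlas M. \<forall>x\<in>\<phi> ` U. \<forall>v\<in>T. \<alpha> (U, \<phi>) x v = \<beta> (U, \<phi>) x v)"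


section \<open>Circle actions and reduction\<close>

definition smooth_circle_action ::
  "('p, 'm::euclidean_space) mfld \<Rightarrow> (complex \<Rightarrow> 'p \<Rightarrow> 'p) \<Rightarrow> bool" where
  "smooth_circle_action P act \<longleftrightarrow>
     (\<forall>z\<in>circle. \<forall>p\<in>points P. act z p \<in> points P) \<and>
     (\<forall>p\<in>points P. act 1 p = p) \<and>
     (\<forall>z\<in>circle. \<forall>w\<in>circle. \<forall>p\<in>points P. act (z * w) p = act z (act w p)) \<and>
     smooth_map (prod_mfld circle_mfld P) P (\<lambda>(z, p). act z p)"

definition free_circle_action_near_boundary ::
  "('p, 'm::euclidean_space) mfld \<Rightarrow> 'p set \<Rightarrow> (complex \<Rightarrow> 'p \<Rightarrow> 'p) \<Rightarrow> bool" where
  "free_circle_action_near_boundary M U act \<longleftrightarrow>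
     openin (mspace M) U \<and> bdry_points M \<subseteq> U \<and>
     smooth_circle_action (submfld M U) act \<and>
     (\<forall>z\<in>circle. \<forall>p\<in>U. act z p = p \<longrightarrow> z = 1)"

definition principal_circle_bundle ::
  "('p, 'm::euclidean_space) mfld \<Rightarrow> (complex \<Rightarrow> 'p \<Rightarrow> 'p) \<Rightarrow> ('q, 'r::euclidean_space) mfld \<Rightarrow>
    ('p \<Rightarrow> 'q) \<Rightarrow> bool" where
  "principal_circle_bundle P act B \<pi> \<longleftrightarrow>
     smooth_circle_action P act \<and> smooth_map P B \<pi> \<and> \<pi> ` points P = points B \<and>
     (\<forall>b\<in>points B. \<exists>W \<Phi>. openin (mspace B) W \<and> b \<in> W \<and>
        diffeo (submfld P (points P \<inter> \<pi> -` W)) (prod_mfld (submfld B W) circle_mfld) \<Phi> \<and>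
        (\<forall>p\<in>points P \<inter> \<pi> -` W. fst (\<Phi> p) = \<pi> p \<and>
           (\<forall>z\<in>circle. \<Phi> (act z p) = (\<pi> p, z * snd (\<Phi> p)))))"

definition orbit :: "(complex \<Rightarrow> 'p \<Rightarrow> 'p) \<Rightarrow> 'p \<Rightarrow> 'p set" where
  "orbit act p = (\<lambda>z. act z p) ` circle"

definition is_reduced_space ::
  "('p, 'm::euclidean_space) mfld \<Rightarrow> (complex \<Rightarrow> 'p \<Rightarrow> 'p) \<Rightarrow> ('p set, 'r::euclidean_space) mfld \<Rightarrow> bool"
  where
  "is_reduced_space M act Mred \<longleftrightarrow>
     manifold Mred \<and> points Mred = orbit act ` bdry_points M \<and>
     principal_circle_bundle (bdry M) act Mred (orbit act)"

definition restr_to_bdry :: "('p, 'm::euclidean_space) mfld \<Rightarrow> ('p, 'm) form1 \<Rightarrow> ('p, 'm) form1" where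
  "restr_to_bdry M \<beta> = pullback M id \<beta>"
  \<comment> \<open>to be evaluated on charts of \<open>bdry M\<close>\<close>

definition basic_on_boundary ::
  "('p, 'm::euclidean_space) mfld \<Rightarrow> (complex \<Rightarrow> 'p \<Rightarrow> 'p) \<Rightarrow> ('p, 'm) form1 \<Rightarrow> bool" where
  "basic_on_boundary M act \<beta> \<longleftrightarrow>
     (\<forall>z\<in>circle. forms_agree bdry_hyperplane (bdry M)
        (pullback (bdry M) (act z) (restr_to_bdry M \<beta>)) (restr_to_bdry M \<beta>)) \<and>
     (\<forall>(U, \<phi>)\<in>atlas (bdry M). \<forall>p\<in>U.
        restr_to_bdry M \<beta> (U, \<phi>) (\<phi> p) (vector_derivative (\<lambda>t. \<phi> (act (cis t) p)) (at 0)) = 0)"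

definition invariant_near_boundary ::
  "('p, 'm::euclidean_space) mfld \<Rightarrow> 'p set \<Rightarrow> (complex \<Rightarrow> 'p \<Rightarrow> 'p) \<Rightarrow> ('p, 'm) form1 \<Rightarrow> bool" where
  "invariant_near_boundary M U act \<beta> \<longleftrightarrow>
     (\<exists>V. openin (mspace M) V \<and> bdry_points M \<subseteq> V \<and> V \<subseteq> U \<and>
        (\<forall>z\<in>circle. act z ` V \<subseteq> V) \<and>
        (\<forall>z\<in>circle. forms_agree UNIV (submfld M V) (pullback M (act z) \<beta>) (pullback M id \<beta>)))"

definition is_reduced_form ::
  "('p, 'm::euclidean_space) mfld \<Rightarrow> (complex \<Rightarrow> 'p \<Rightarrow> 'p) \<Rightarrow> ('p set, 'r::euclidean_space) mfld \<Rightarrow>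
    ('p, 'm) form1 \<Rightarrow> ('p set, 'r) form1 \<Rightarrow> bool" where
  "is_reduced_form M act Mred \<beta> \<beta>red \<longleftrightarrow>
     one_form Mred \<beta>red \<and>
     forms_agree bdry_hyperplane (bdry M) (pullback Mred (orbit act) \<beta>red) (restr_to_bdry M \<beta>)"

end

theory Submission
  imports Defs
begin

text \<open>
  At a boundary point let \<open>X\<close> generate the circle orbit, let \<open>N\<close> be transverse to the boundary and let
  \<open>h\<close> range over lifts of tangent vectors of the reduced space. Since the pullback of \<open>\<beta>\<close> to the
  boundary is the pullback of \<open>\<beta>red\<close>, and exterior derivatives commute with pullbacks, both \<open>\<beta>\<close> and
  \<open>d\<beta>\<close>, restricted to the boundary, are annihilated by \<open>X\<close>. Hence \<open>\<beta> \<and> (d\<beta>)^n\<close> evaluated on the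
  \<open>h\<close> followed by \<open>X\<close> and \<open>N\<close> is a multiple of \<open>d\<beta>(X, N)\<close> times \<open>\<beta>red \<and> (d\<beta>red)^(n - 1)\<close> evaluated on
  the tangent vectors lifted by the \<open>h\<close>, which therefore cannot vanish.
\<close>

section \<open>Antisymmetrized products of a one-form and a two-form\<close>

text \<open>Boundary charts take values in a hyperplane, where \<open>frechet_derivative\<close>
  within the chart image is one choice among many derivatives and only its values on hyperplane
  vectors are meaningful. Derivatives are therefore compared along curves that stay in the chart
  image, where they are determined. In charts the projection to the reduced space is replaced by a
  smooth extension \<open>G\<close> to an open subset of the model space, so that ordinary second
  derivatives are available; their symmetry is why exterior derivative and pullback commute. The
  lifts and \<open>X\<close> come from the inverse of a local trivialization of the circle bundle.
  Evaluation on one family suffices because the \<open>h\<close>, \<open>X\<close> and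
  \<open>N\<close> span, and an alternating multilinear form that vanishes on a spanning family
  vanishes identically. To use this, the nested wedge products are flattened into a single sum over
  permutations. Finally, counting dimensions gives \<open>DIM('m) = DIM('r) + 2\<close>, so
  \<open>n\<close> is positive wherever there is a boundary point and the truncated
  \<open>n - 1\<close> is harmless.\<close>

lemma shift_permutation:
  fixes \<tau> :: "nat \<Rightarrow> nat"
  assumes "\<tau> permutes {..<l}"
  obtains \<tau>' where "\<tau>' permutes {..<k + l}" "sign \<tau>' = sign \<tau>"
    "\<And>i. i < k \<Longrightarrow> \<tau>' i = i" "\<And>i. \<tau>' (k + i) = k + \<tau> i"
proof
  \<comment> \<open>\<open>\<tau>\<close> is transported to the last \<open>l\<close> slots by
    adding \<open>k\<close> and extended by the identity. Since \<open>\<tau>\<close> fixes all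
    indices from \<open>l\<close> on, the last clause holds for every \<open>i\<close>.\<close>
  let ?t = "map_permutation {..<l} ((+) k) \<tau>"
  have im: "(+) k ` {..<l} = {k..<k + l}"
    by (simp add: lessThan_atLeast0 add.commute)
  have p: "?t permutes {k..<k + l}"
    by (rule map_permutation_permutes[OF _ assms]) (auto simp: bij_betw_def im)
  then show "?t permutes {..<k + l}"
    by (rule permutes_subset) auto
  show "sign ?t = sign \<tau>"
    using assms by (intro sign_map_permutation) auto
  show "?t i = i" if "i < k" for i
    using permutes_not_in[OF p, of i] that by simp
  show "?t (k + i) = k + \<tau> i" for i
  proof (cases "i < l")
    case True
    then show ?thesis using map_permutation_apply[of "(+) k" "{..<l}" i \<tau>] by simp
  next
    case False
    then show ?thesis
      using permutes_not_in[OF p, of "k + i"] permutes_not_in[OF assms, of i] by simp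
  qed
qed

text \<open>Since \<open>b\<close> is itself an antisymmetrization, each of the \<open>l!\<close>
  inner permutations can be absorbed into the outer one by acting on the last \<open>l\<close>
  slots, which \<open>a\<close> does not see. All inner terms then give the same sum, and
  \<open>l!\<close> cancels the \<open>fact l\<close> in \<open>wedge\<close>.\<close>

lemma wedge_antisymmetrization:
  assumes a: "\<And>u u'. (\<And>i. i < k \<Longrightarrow> u i = u' i) \<Longrightarrow> a u = a u'"
    and b: "\<And>u. b u = c * (\<Sum>\<tau> | \<tau> permutes {..<l}. of_int (sign \<tau>) * f (\<lambda>i. u (\<tau> i)))"
  shows "wedge k l a b v = c / fact k *
    (\<Sum>\<sigma> | \<sigma> permutes {..<k + l}.
       of_int (sign \<sigma>) * a (\<lambda>i. v (\<sigma> i)) * f (\<lambda>i. v (\<sigma> (k + i))))"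
proof -
  let ?P = "\<lambda>m. {\<sigma>::nat \<Rightarrow> nat. \<sigma> permutes {..<m}}"
  define g where "g \<sigma> = of_int (sign \<sigma>) * a (\<lambda>i. v (\<sigma> i)) * f (\<lambda>i. v (\<sigma> (k + i)))" for \<sigma>
  have reindex: "(\<Sum>\<sigma>\<in>?P (k + l). of_int (sign \<sigma>) * a (\<lambda>i. v (\<sigma> i)) *
      (of_int (sign \<tau>) * f (\<lambda>i. v (\<sigma> (k + \<tau> i))))) = sum g (?P (k + l))"
    if \<tau>: "\<tau> permutes {..<l}" for \<tau>
  proof -
    obtain \<tau>' where \<tau>': "\<tau>' permutes {..<k + l}" "sign \<tau>' = sign \<tau>"
      "\<And>i. i < k \<Longrightarrow> \<tau>' i = i" "\<And>i. \<tau>' (k + i) = k + \<tau> i"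
      using shift_permutation[OF \<tau>] by metis
    have "sum g (?P (k + l)) = (\<Sum>\<sigma>\<in>?P (k + l). g (\<sigma> \<circ> \<tau>'))"
      by (rule sum_permutations_compose_right[OF \<tau>'(1)])
    also have "\<dots> = (\<Sum>\<sigma>\<in>?P (k + l). of_int (sign \<sigma>) * a (\<lambda>i. v (\<sigma> i)) *
      (of_int (sign \<tau>) * f (\<lambda>i. v (\<sigma> (k + \<tau> i)))))"
    proof (rule sum.cong[OF refl])
      fix \<sigma> assume "\<sigma> \<in> ?P (k + l)"
      then have "sign (\<sigma> \<circ> \<tau>') = sign \<sigma> * sign \<tau>"
        using \<tau>'(1,2) by (metis finite_lessThan mem_Collect_eq permutes_imp_permutation sign_compose)
      moreover have "a (\<lambda>i. v ((\<sigma> \<circ> \<tau>') i)) = a (\<lambda>i. v (\<sigma> i))"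
        by (rule a) (simp add: \<tau>'(3))
      ultimately show "g (\<sigma> \<circ> \<tau>') = of_int (sign \<sigma>) * a (\<lambda>i. v (\<sigma> i)) *
          (of_int (sign \<tau>) * f (\<lambda>i. v (\<sigma> (k + \<tau> i))))"
        by (simp add: g_def \<tau>'(4))
    qed
    finally show ?thesis by simp
  qed
  have "(\<Sum>\<sigma>\<in>?P (k + l). of_int (sign \<sigma>) * a (\<lambda>i. v (\<sigma> i)) * b (\<lambda>i. v (\<sigma> (k + i))))
     = c * (\<Sum>\<sigma>\<in>?P (k + l). \<Sum>\<tau>\<in>?P l. of_int (sign \<sigma>) * a (\<lambda>i. v (\<sigma> i)) *
        (of_int (sign \<tau>) * f (\<lambda>i. v (\<sigma> (k + \<tau> i)))))"
    by (simp add: b sum_distrib_left mult_ac)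
  also have "\<dots> = c * (\<Sum>\<tau>\<in>?P l. sum g (?P (k + l)))"
    by (subst sum.swap) (simp add: reindex)
  also have "\<dots> = c * fact l * sum g (?P (k + l))"
    by (simp add: card_permutations[OF refl])
  finally show ?thesis
    unfolding wedge_def g_def by simp
qed

text \<open>Flattening consumes the normalization of the inner power at each step and leaves only
  \<open>1 / fact 2\<close> for the new factor; hence \<open>1 / 2 ^ n\<close> and no factorial of
  \<open>2 * n\<close>.\<close>

lemma wedge_power_eq_sum:
  assumes w: "\<And>u u'. u 0 = u' 0 \<Longrightarrow> u 1 = u' 1 \<Longrightarrow> w u = w u'"
  shows "wedge_power w n v = 1 / 2 ^ n *
    (\<Sum>\<sigma> | \<sigma> permutes {..<2 * n}. of_int (sign \<sigma>) * (\<Prod>i<n. w (\<lambda>j. v (\<sigma> (2 * i + j)))))"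
proof (induction n arbitrary: v)
  case (Suc n)
  let ?f = "\<lambda>u. \<Prod>i<n. w (\<lambda>j. u (2 * i + j))"
  have "wedge_power w (Suc n) v = (1 / 2 ^ n) / fact 2 * (\<Sum>\<sigma> | \<sigma> permutes {..<2 + 2 * n}.
       of_int (sign \<sigma>) * w (\<lambda>i. v (\<sigma> i)) * ?f (\<lambda>i. v (\<sigma> (2 + i))))"
    unfolding wedge_power.simps
    by (rule wedge_antisymmetrization[where f = ?f], rule w, simp, simp, rule Suc.IH)
  then show ?case
    by (simp add: prod.lessThan_Suc_shift add.assoc mult.assoc del: prod.lessThan_Suc)
qed simp

text \<open>This is \<open>2 ^ n\<close> times the wedge product of \<open>b\<close> with the
  \<open>n\<close>-th power of \<open>w\<close>, with \<open>w\<close> curried: position 0 feeds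
  \<open>b\<close>, positions \<open>2 * i + 1\<close> and \<open>2 * i + 2\<close> feed the
  \<open>i\<close>-th copy of \<open>w\<close>.\<close>

definition contact_sum :: "nat \<Rightarrow> ('m \<Rightarrow> real) \<Rightarrow> ('m \<Rightarrow> 'm \<Rightarrow> real) \<Rightarrow> (nat \<Rightarrow> 'm) \<Rightarrow> real" where
  "contact_sum n b w v = (\<Sum>\<sigma> | \<sigma> permutes {..<2 * n + 1}. of_int (sign \<sigma>) *
     (b (v (\<sigma> 0)) * (\<Prod>i<n. w (v (\<sigma> (2 * i + 1))) (v (\<sigma> (2 * i + 2))))))"

lemma contact_wedge_eq_sum:
  "wedge 1 (2 * n) (\<lambda>v. b (v 0)) (wedge_power (\<lambda>v. w (v 0) (v 1)) n) v =
     1 / 2 ^ n * contact_sum n b w v"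
proof -
  let ?f = "\<lambda>u. \<Prod>i<n. w (u (2 * i)) (u (2 * i + 1))"
  have "wedge 1 (2 * n) (\<lambda>v. b (v 0)) (wedge_power (\<lambda>v. w (v 0) (v 1)) n) v =
    (1 / 2 ^ n) / fact 1 * (\<Sum>\<sigma> | \<sigma> permutes {..<1 + 2 * n}.
       of_int (sign \<sigma>) * b (v (\<sigma> 0)) * ?f (\<lambda>i. v (\<sigma> (1 + i))))"
  proof (rule wedge_antisymmetrization)
    show "wedge_power (\<lambda>v. w (v 0) (v 1)) n u = 1 / 2 ^ n *
      (\<Sum>\<tau> | \<tau> permutes {..<2 * n}. of_int (sign \<tau>) * ?f (\<lambda>i. u (\<tau> i)))" for u
      by (subst wedge_power_eq_sum) simp_all
  qed simp
  then show ?thesis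
    by (simp add: contact_sum_def mult.assoc)
qed

section \<open>Alternation and multilinearity of the contact sum\<close>

lemma contact_sum_permute:
  assumes \<rho>: "\<rho> permutes {..<2 * n + 1}"
  shows "contact_sum n b w (\<lambda>i. v (\<rho> i)) = of_int (sign \<rho>) * contact_sum n b w v"
proof -
  let ?g = "\<lambda>\<sigma>. of_int (sign \<sigma>) *
     (b (v (\<sigma> 0)) * (\<Prod>i<n. w (v (\<sigma> (2 * i + 1))) (v (\<sigma> (2 * i + 2)))))"
  have "contact_sum n b w v = (\<Sum>\<sigma> | \<sigma> permutes {..<2 * n + 1}. ?g (\<rho> \<circ> \<sigma>))"
    unfolding contact_sum_def by (rule setum_permutations_compose_left[OF \<rho>])
  also have "\<dots> = of_int (sign \<rho>) * contact_sum n b w (\<lambda>i. v (\<rho> i))"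
    unfolding contact_sum_def sum_distrib_left
  proof (rule sum.cong[OF refl])
    fix \<sigma> assume "\<sigma> \<in> {\<sigma>. \<sigma> permutes {..<2 * n + 1}}"
    then have "sign (\<rho> \<circ> \<sigma>) = sign \<rho> * sign \<sigma>"
      using \<rho> by (metis finite_lessThan mem_Collect_eq permutes_imp_permutation sign_compose)
    then show "?g (\<rho> \<circ> \<sigma>) = of_int (sign \<rho>) * (of_int (sign \<sigma>) *
     (b (v (\<rho> (\<sigma> 0))) * (\<Prod>i<n. w (v (\<rho> (\<sigma> (2 * i + 1)))) (v (\<rho> (\<sigma> (2 * i + 2)))))))"
      by simp
  qed
  finally have "contact_sum n b w v = of_int (sign \<rho>) * contact_sum n b w (\<lambda>i. v (\<rho> i))" .
  moreover have "real_of_int (sign \<rho>) * of_int (sign \<rho>) = 1"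
    by (metis of_int_1 of_int_mult sign_idempotent)
  ultimately show ?thesis by simp
qed

lemma contact_sum_repeated:
  assumes "v i = v j" "i \<noteq> j" "i < 2 * n + 1" "j < 2 * n + 1"
  shows "contact_sum n b w v = 0"
proof -
  let ?t = "Transposition.transpose i j"
  have "?t permutes {..<2 * n + 1}"
    using assms by (intro permutes_swap_id) auto
  moreover have "(\<lambda>k. v (?t k)) = v"
    using assms(1) by (auto simp: Transposition.transpose_def)
  ultimately have "contact_sum n b w v = of_int (sign ?t) * contact_sum n b w v"
    by (metis contact_sum_permute)
  then show ?thesis using assms(2) by (simp add: sign_swap_id)
qed

text \<open>The two sides may live on different vector spaces; this moves the sum from lifted
  vectors to vectors of the reduced space.\<close>

lemma contact_sum_cong:
  assumes "\<And>i. i < 2 * n + 1 \<Longrightarrow> b (v i) = b' (v' i)"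
    and "\<And>i j. i < 2 * n + 1 \<Longrightarrow> j < 2 * n + 1 \<Longrightarrow> w (v i) (v j) = w' (v' i) (v' j)"
  shows "contact_sum n b w v = contact_sum n b' w' v'"
  unfolding contact_sum_def
proof (intro sum.cong arg_cong2[where f = "(*)"] prod.cong refl)
  fix \<sigma> assume "\<sigma> \<in> {\<sigma>. \<sigma> permutes {..<2 * n + 1}}"
  then have lt: "\<sigma> i < 2 * n + 1" if "i < 2 * n + 1" for i
    using permutes_in_image[of \<sigma> "{..<2 * n + 1}" i] that by auto
  show "b (v (\<sigma> 0)) = b' (v' (\<sigma> 0))"
    by (intro assms lt) simp
  show "w (v (\<sigma> (2 * i + 1))) (v (\<sigma> (2 * i + 2))) = w' (v' (\<sigma> (2 * i + 1))) (v' (\<sigma> (2 * i + 2)))"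
    if "i \<in> {..<n}" for i
    using that by (intro assms lt) auto
qed

text \<open>In each summand the slot \<open>k\<close> is read at exactly one position,
  \<open>j = inv \<sigma> k\<close>, so it enters a single factor, which is linear in it; all other
  factors are constants.\<close>

lemma linear_contact_sum_slot:
  fixes b :: "'m::real_vector \<Rightarrow> real"
  assumes b: "linear b" and w: "\<And>u. linear (w u)" "\<And>u. linear (\<lambda>x. w x u)"
    and k: "k < 2 * n + 1"
  shows "linear (\<lambda>x. contact_sum n b w (v(k := x)))"
  unfolding contact_sum_def
proof (rule linear_compose_sum, safe)
  fix \<sigma> :: "nat \<Rightarrow> nat" assume \<sigma>: "\<sigma> permutes {..<2 * n + 1}"
  let ?u = "\<lambda>x j. (v(k := x)) (\<sigma> j)"
  let ?h = "\<lambda>x i. w (?u x (2 * i + 1)) (?u x (2 * i + 2))"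
  define j where "j = inv \<sigma> k"
  have j: "\<sigma> j = k" "j < 2 * n + 1"
    using permutes_inverses(1)[OF \<sigma>] permutes_in_image[OF \<sigma>, of j] k by (auto simp: j_def)
  have other: "?u x i = v (\<sigma> i)" if "i \<noteq> j" for x i
    using that j permutes_inj[OF \<sigma>] by (auto simp: inj_def)
  have "linear (\<lambda>x. b (?u x 0) * (\<Prod>i<n. ?h x i))"
  proof (cases "j = 0")
    case True
    then have "(\<lambda>x. b (?u x 0) * (\<Prod>i<n. ?h x i)) =
        (\<lambda>x. b x * (\<Prod>i<n. w (v (\<sigma> (2 * i + 1))) (v (\<sigma> (2 * i + 2)))))"
      using j(1) other by (simp del: fun_upd_apply) (simp add: fun_eq_iff)
    then show ?thesis
      using linear_compose_scale_right[OF b, of "\<Prod>i<n. w (v (\<sigma> (2 * i + 1))) (v (\<sigma> (2 * i + 2)))"]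
      by (simp add: mult.commute)
  next
    case False
    \<comment> \<open>Positions \<open>2 * i + 1\<close> and \<open>2 * i + 2\<close> belong to the
      \<open>i\<close>-th copy of \<open>w\<close>, so this is the copy that reads position
      \<open>j\<close>.\<close>
    define i0 where "i0 = (j - 1) div 2"
    have i0: "i0 < n" "j = 2 * i0 + 1 \<or> j = 2 * i0 + 2"
      using False j(2) unfolding i0_def by presburger+
    have rest: "?h x i = w (v (\<sigma> (2 * i + 1))) (v (\<sigma> (2 * i + 2)))" if "i \<noteq> i0" for x i
    proof -
      have "2 * i + 1 \<noteq> j" "2 * i + 2 \<noteq> j"
        using that i0(2) by presburger+
      then show ?thesis by (rule arg_cong2[where f = w, OF other other])
    qed
    have "?u x 0 = v (\<sigma> 0)" for x
      using False by (simp only: other)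
    then have eq: "(\<lambda>x. b (?u x 0) * (\<Prod>i<n. ?h x i)) = (\<lambda>x. (b (v (\<sigma> 0)) *
        (\<Prod>i\<in>{..<n} - {i0}. w (v (\<sigma> (2 * i + 1))) (v (\<sigma> (2 * i + 2))))) *\<^sub>R ?h x i0)"
      using i0(1) rest by (subst prod.remove[of _ i0]) (auto simp del: fun_upd_apply)
    have "linear (\<lambda>x. ?h x i0)"
      using i0(2)
    proof
      assume e: "j = 2 * i0 + 1"
      then have "?u x (2 * i0 + 2) = v (\<sigma> (2 * i0 + 2))" for x
        by (intro other) simp
      moreover have "?u x (2 * i0 + 1) = x" for x
        using e j(1) by simp
      ultimately show ?thesis using w(2) by presburger
    next
      assume e: "j = 2 * i0 + 2"
      then have "?u x (2 * i0 + 1) = v (\<sigma> (2 * i0 + 1))" for x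
        by (intro other) simp
      moreover have "?u x (2 * i0 + 2) = x" for x
        using e j(1) by simp
      ultimately show ?thesis using w(1) by presburger
    qed
    then show ?thesis
      unfolding eq by (rule linear_compose_scale_right)
  qed
  then show "linear (\<lambda>x. of_int (sign \<sigma>) * (b (?u x 0) * (\<Prod>i<n. ?h x i)))"
    using linear_compose_scale_right[of "\<lambda>x. b (?u x 0) * (\<Prod>i<n. ?h x i)" "of_int (sign \<sigma>)"]
    by (simp del: fun_upd_apply)
qed

text \<open>Multilinearity reduces arbitrary arguments to members of the spanning family, one slot
  at a time; on members of the family, either some index repeats or the indices form a
  permutation.\<close>

lemma contact_sum_eq_0_if_0_on_spanning:
  fixes b :: "'m::real_vector \<Rightarrow> real"
  assumes b: "linear b" and w: "\<And>u. linear (w u)" "\<And>u. linear (\<lambda>x. w x u)"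
    and e: "span (e ` {..<2 * n + 1}) = UNIV" "contact_sum n b w e = 0"
  shows "contact_sum n b w v = 0"
proof -
  let ?d = "2 * n + 1"
  \<comment> \<open>Slots below \<open>k\<close> are still arbitrary, those from \<open>k\<close> on
    hold members of the family. At \<open>k = ?d\<close> the condition is void.\<close>
  have "contact_sum n b w v = 0" if "\<forall>i. k \<le> i \<longrightarrow> i < ?d \<longrightarrow> v i \<in> e ` {..<?d}" for k v
    using that
  proof (induction k arbitrary: v)
    case 0
    then have "\<forall>i. \<exists>j. i < ?d \<longrightarrow> j < ?d \<and> v i = e j"
      by auto
    then obtain f where f: "\<And>i. i < ?d \<Longrightarrow> f i < ?d \<and> v i = e (f i)"
      by metis
    show ?case
    proof (cases "inj_on f {..<?d}")
      case True
      define \<rho> where "\<rho> i = (if i < ?d then f i else i)" for i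
      have "inj_on \<rho> {..<?d}"
        using True by (auto simp: inj_on_def \<rho>_def)
      moreover have "\<rho> ` {..<?d} \<subseteq> {..<?d}"
        using f by (auto simp: \<rho>_def)
      ultimately have "bij_betw \<rho> {..<?d} {..<?d}"
        by (simp add: bij_betw_def endo_inj_surj)
      then have "\<rho> permutes {..<?d}"
        by (rule bij_imp_permutes) (auto simp: \<rho>_def)
      then have "contact_sum n b w (\<lambda>i. e (\<rho> i)) = 0"
        using e(2) by (simp add: contact_sum_permute del: One_nat_def)
      moreover have "contact_sum n b w v = contact_sum n b w (\<lambda>i. e (\<rho> i))"
        using f by (intro contact_sum_cong) (auto simp: \<rho>_def)
      ultimately show ?thesis by simp
    next
      case False
      then obtain i j where "i < ?d" "j < ?d" "i \<noteq> j" "f i = f j"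
        by (auto simp: inj_on_def)
      then show ?thesis
        using f by (metis contact_sum_repeated)
    qed
  next
    case (Suc k)
    show ?case
    proof (cases "k < ?d")
      case True
      let ?L = "\<lambda>x. contact_sum n b w (v(k := x))"
      have "?L x = 0" if "x \<in> e ` {..<?d}" for x
      proof (rule Suc.IH, intro allI impI)
        fix i assume "k \<le> i" "i < ?d"
        then show "(v(k := x)) i \<in> e ` {..<?d}"
          using Suc.prems that by (cases "i = k") auto
      qed
      moreover have "v k \<in> span (e ` {..<?d})"
        unfolding e(1) by (rule UNIV_I)
      ultimately have "?L (v k) = 0"
        by (rule linear_eq_0_on_span[OF linear_contact_sum_slot[OF b w True]])
      then show ?thesis by simp
    next
      case False
      then have "\<forall>i. k \<le> i \<longrightarrow> i < ?d \<longrightarrow> v i \<in> e ` {..<?d}" by auto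
      then show ?thesis by (rule Suc.IH)
    qed
  qed
  from this[of ?d] show ?thesis by auto
qed

text \<open>The factor \<open>2 * real (Suc m)\<close> counts the places for \<open>X\<close> and
  \<open>N\<close>: \<open>Suc m\<close> copies of \<open>w\<close> and two orders in each, all
  contributing equally. With \<open>X\<close> and \<open>N\<close> fixed in the last copy, what
  remains is the contact sum over the first \<open>2 * m + 1\<close> vectors.\<close>

lemma contact_sum_contract:
  fixes b :: "'m \<Rightarrow> real" and v :: "nat \<Rightarrow> 'm" and m :: nat
  defines "X \<equiv> v (2 * m + 1)" and "N \<equiv> v (2 * m + 2)"
  assumes bX: "b X = 0"
    and wX: "\<And>j. j < 2 * m + 1 \<Longrightarrow> w X (v j) = 0 \<and> w (v j) X = 0"
    and wN: "w N X = - w X N"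
  shows "contact_sum (Suc m) b w v = 2 * real (Suc m) * w X N * contact_sum m b w v"
proof -
  define P where "P = {\<sigma>. \<sigma> permutes {..<2 * Suc m + 1}}"
  define h where "h \<sigma> i = w (v (\<sigma> (2 * i + 1))) (v (\<sigma> (2 * i + 2)))" for \<sigma> :: "nat \<Rightarrow> nat" and i
  define f where "f \<sigma> = of_int (sign \<sigma>) * (b (v (\<sigma> 0)) * (\<Prod>i<Suc m. h \<sigma> i))" for \<sigma> :: "nat \<Rightarrow> nat"
  define A where "A i \<sigma> \<longleftrightarrow> \<sigma> (2 * i + 1) = 2 * m + 1 \<and> \<sigma> (2 * i + 2) = 2 * m + 2" for \<sigma> :: "nat \<Rightarrow> nat" and i
  define A' where "A' i \<sigma> \<longleftrightarrow> \<sigma> (2 * i + 1) = 2 * m + 2 \<and> \<sigma> (2 * i + 2) = 2 * m + 1" for \<sigma> :: "nat \<Rightarrow> nat" and i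
  \<comment> \<open>Only the permutations that put \<open>X\<close> and \<open>N\<close> into the same factor \<open>w\<close> contribute;
    \<open>A i\<close> and \<open>A' i\<close> select those that put them, in either order, into the \<open>i\<close>-th factor.\<close>
  have finP: "finite P"
    unfolding P_def by (simp add: finite_permutations)
  have sign_comp: "sign (\<sigma> \<circ> \<rho>) = sign \<sigma> * sign \<rho>" if "\<sigma> \<in> P" "\<rho> \<in> P" for \<sigma> \<rho>
    using that unfolding P_def by (metis finite_lessThan mem_Collect_eq permutes_imp_permutation sign_compose)
  \<comment> \<open>If \<open>f \<sigma>\<close> is nonzero, \<open>X\<close> is not at position 0
    because \<open>b X = 0\<close>, and \<open>wX\<close> leaves only \<open>N\<close> as its
    partner in a copy of \<open>w\<close>. So exactly one of all the conditions \<open>A i\<close>,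
    \<open>A' i\<close> holds.\<close>
  have split: "f \<sigma> = (\<Sum>i<Suc m. (if A i \<sigma> then f \<sigma> else 0) + (if A' i \<sigma> then f \<sigma> else 0))"
    if "\<sigma> \<in> P" for \<sigma>
  proof (cases "f \<sigma> = 0")
    case False
    have \<sigma>: "\<sigma> permutes {..<2 * Suc m + 1}" using that by (simp add: P_def)
    note inj = permutes_inj[OF \<sigma>, unfolded inj_def, rule_format]
    define j where "j = inv \<sigma> (2 * m + 1)"
    have j: "\<sigma> j = 2 * m + 1" "j < 2 * m + 3"
      using permutes_inverses(1)[OF \<sigma>] permutes_in_image[OF \<sigma>, of j] by (auto simp: j_def)
    have "j \<noteq> 0"
    proof
      assume "j = 0"
      then have "f \<sigma> = 0" using j(1) bX by (simp add: f_def X_def)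
      then show False using False by simp
    qed
    define i0 where "i0 = (j - 1) div 2"
    have i0: "i0 < Suc m" "j = 2 * i0 + 1 \<or> j = 2 * i0 + 2"
      using \<open>j \<noteq> 0\<close> j(2) unfolding i0_def by presburger+
    have h0: "h \<sigma> i0 \<noteq> 0"
    proof
      assume "h \<sigma> i0 = 0"
      then have "(\<Prod>i<Suc m. h \<sigma> i) = 0" using i0(1) by (intro prod_zero) auto
      then show False using False by (simp add: f_def)
    qed
    have "A i0 \<sigma> \<or> A' i0 \<sigma>"
      using i0(2)
    proof
      assume e: "j = 2 * i0 + 1"
      let ?q = "\<sigma> (2 * i0 + 2)"
      have "?q \<noteq> 2 * m + 1" "?q < 2 * Suc m + 1"
        using inj[of "2 * i0 + 2" j] j e permutes_in_image[OF \<sigma>, of "2 * i0 + 2"] i0(1) by auto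
      moreover have "\<not> ?q < 2 * m + 1"
        using wX[of ?q] h0 e j(1) by (auto simp: h_def X_def)
      ultimately have "?q = 2 * m + 2" by arith
      then show ?thesis using j(1) e by (simp add: A_def)
    next
      assume e: "j = 2 * i0 + 2"
      let ?q = "\<sigma> (2 * i0 + 1)"
      have "?q \<noteq> 2 * m + 1" "?q < 2 * Suc m + 1"
        using inj[of "2 * i0 + 1" j] j e permutes_in_image[OF \<sigma>, of "2 * i0 + 1"] i0(1) by auto
      moreover have "\<not> ?q < 2 * m + 1"
        using wX[of ?q] h0 e j(1) by (auto simp: h_def X_def)
      ultimately have "?q = 2 * m + 2" by arith
      then show ?thesis using j(1) e by (simp add: A'_def)
    qed
    moreover have "\<not> (A i0 \<sigma> \<and> A' i0 \<sigma>)"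
      by (auto simp: A_def A'_def)
    moreover have "\<not> A i \<sigma> \<and> \<not> A' i \<sigma>" if "i \<noteq> i0" for i
    proof -
      have "2 * i + 1 \<noteq> j" "2 * i + 2 \<noteq> j"
        using that i0(2) by presburger+
      then show ?thesis
        using inj[of "2 * i + 1" j] inj[of "2 * i + 2" j] j(1) by (auto simp: A_def A'_def)
    qed
    ultimately have "(\<Sum>i<Suc m. (if A i \<sigma> then f \<sigma> else 0) + (if A' i \<sigma> then f \<sigma> else 0))
        = (\<Sum>i<Suc m. if i = i0 then f \<sigma> else 0)"
      by (intro sum.cong) auto
    then show ?thesis using i0(1) by simp
  next
    case True
    then have "(if A i \<sigma> then f \<sigma> else 0) + (if A' i \<sigma> then f \<sigma> else 0) = 0" for i
      by simp
    then show ?thesis using True by (simp only: sum.neutral_const)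
  qed
  define S where "S = (\<Sum>\<sigma>\<in>P. if A m \<sigma> then f \<sigma> else 0)"
  \<comment> \<open>\<open>\<rho>\<close> exchanges the \<open>i\<close>-th and the last pair of
    positions. It is even, being a product of two transpositions (trivial ones if
    \<open>i = m\<close>), and merely reorders the product.\<close>
  have pairs: "(\<Sum>\<sigma>\<in>P. if A i \<sigma> then f \<sigma> else 0) = S"
      "(\<Sum>\<sigma>\<in>P. if A' i \<sigma> then f \<sigma> else 0) = (\<Sum>\<sigma>\<in>P. if A' m \<sigma> then f \<sigma> else 0)"
    if i: "i < Suc m" for i
  proof -
    define t1 t2 where "t1 = Transposition.transpose (2 * i + 1) (2 * m + 1)"
      and "t2 = Transposition.transpose (2 * i + 2) (2 * m + 2)"
    define \<rho> where "\<rho> = t1 \<circ> t2"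
    let ?\<tau> = "Transposition.transpose i m"
    have t: "t1 \<in> P" "t2 \<in> P"
      unfolding t1_def t2_def P_def using i by (auto intro!: permutes_swap_id)
    have "sign \<rho> = 1"
      using sign_comp[OF t] by (simp add: \<rho>_def t1_def t2_def sign_swap_id)
    have \<rho>: "\<rho> permutes {..<2 * Suc m + 1}"
      using t unfolding P_def \<rho>_def by (auto intro: permutes_compose)
    then have "\<rho> \<in> P" by (simp add: P_def)
    have \<rho>1: "\<rho> (2 * l + 1) = 2 * ?\<tau> l + 1" for l
    proof -
      have "2 * l + 1 \<noteq> 2 * i + 2" "2 * l + 1 \<noteq> 2 * m + 2" by presburger+
      then have "t2 (2 * l + 1) = 2 * l + 1" by (simp add: t2_def)
      then show ?thesis by (auto simp: \<rho>_def t1_def Transposition.transpose_def)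
    qed
    have \<rho>2: "\<rho> (2 * l + 2) = 2 * ?\<tau> l + 2" for l
    proof -
      have t2: "t2 (2 * l + 2) = 2 * ?\<tau> l + 2" by (auto simp: t2_def Transposition.transpose_def)
      have "2 * ?\<tau> l + 2 \<noteq> 2 * i + 1" "2 * ?\<tau> l + 2 \<noteq> 2 * m + 1" by presburger+
      then show ?thesis unfolding \<rho>_def o_def t2 t1_def by (rule transpose_apply_other)
    qed
    have "\<rho> 0 = 0" by (simp add: \<rho>_def t1_def t2_def)
    have \<tau>: "?\<tau> permutes {..<Suc m}" using i by (intro permutes_swap_id) auto
    have f: "f (\<sigma> \<circ> \<rho>) = f \<sigma>" if "\<sigma> \<in> P" for \<sigma>
    proof -
      have "(\<Prod>l<Suc m. h (\<sigma> \<circ> \<rho>) l) = (\<Prod>l<Suc m. h \<sigma> (?\<tau> l))"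
        unfolding h_def o_def \<rho>1 \<rho>2 ..
      also have "\<dots> = (\<Prod>l<Suc m. h \<sigma> l)"
        using prod.permute[OF \<tau>, of "h \<sigma>"] unfolding o_def ..
      finally have "(\<Prod>l<Suc m. h (\<sigma> \<circ> \<rho>) l) = (\<Prod>l<Suc m. h \<sigma> l)" .
      moreover have "sign (\<sigma> \<circ> \<rho>) = sign \<sigma>"
        using sign_comp[OF that \<open>\<rho> \<in> P\<close>] \<open>sign \<rho> = 1\<close> by simp
      moreover have "(\<sigma> \<circ> \<rho>) 0 = \<sigma> 0"
        using \<open>\<rho> 0 = 0\<close> by simp
      ultimately show ?thesis by (simp only: f_def)
    qed
    have AA: "A i (\<sigma> \<circ> \<rho>) \<longleftrightarrow> A m \<sigma>" "A' i (\<sigma> \<circ> \<rho>) \<longleftrightarrow> A' m \<sigma>" for \<sigma>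
      unfolding A_def A'_def o_def \<rho>1 \<rho>2 by simp_all
    have comp: "(\<Sum>\<sigma>\<in>P. F \<sigma>) = (\<Sum>\<sigma>\<in>P. F (\<sigma> \<circ> \<rho>))" for F :: "(nat \<Rightarrow> nat) \<Rightarrow> real"
      unfolding P_def by (rule sum_permutations_compose_right[OF \<rho>])
    show "(\<Sum>\<sigma>\<in>P. if A i \<sigma> then f \<sigma> else 0) = S"
      unfolding S_def by (rule trans[OF comp sum.cong[OF refl]]) (simp only: f AA)
    show "(\<Sum>\<sigma>\<in>P. if A' i \<sigma> then f \<sigma> else 0) = (\<Sum>\<sigma>\<in>P. if A' m \<sigma> then f \<sigma> else 0)"
      by (rule trans[OF comp sum.cong[OF refl]]) (simp only: f AA)
  qed
  \<comment> \<open>Exchanging the last two positions costs a sign, which \<open>wN\<close>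
    compensates.\<close>
  have flip: "(\<Sum>\<sigma>\<in>P. if A' m \<sigma> then f \<sigma> else 0) = S"
  proof -
    define \<rho> where "\<rho> = Transposition.transpose (2 * m + 1) (2 * m + 2)"
    have \<rho>: "\<rho> permutes {..<2 * Suc m + 1}"
      unfolding \<rho>_def by (auto intro!: permutes_swap_id)
    then have "\<rho> \<in> P" by (simp add: P_def)
    have f: "f (\<sigma> \<circ> \<rho>) = f \<sigma>" if "\<sigma> \<in> P" "A m \<sigma>" for \<sigma>
    proof -
      have "h (\<sigma> \<circ> \<rho>) l = h \<sigma> l" if "l < m" for l
        using that by (simp add: h_def \<rho>_def)
      then have "(\<Prod>l<m. h (\<sigma> \<circ> \<rho>) l) = (\<Prod>l<m. h \<sigma> l)"
        by simp
      moreover have "h (\<sigma> \<circ> \<rho>) m = - h \<sigma> m"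
        using that(2) wN by (simp add: h_def A_def \<rho>_def X_def N_def)
      moreover have "\<rho> 0 = 0" by (simp add: \<rho>_def)
      moreover have "sign (\<sigma> \<circ> \<rho>) = - sign \<sigma>"
        using sign_comp[OF that(1) \<open>\<rho> \<in> P\<close>] by (simp add: \<rho>_def sign_swap_id)
      ultimately show ?thesis
        by (simp add: f_def)
    qed
    have A'A: "A' m (\<sigma> \<circ> \<rho>) \<longleftrightarrow> A m \<sigma>" for \<sigma>
      by (auto simp: A_def A'_def \<rho>_def)
    show ?thesis
      unfolding P_def S_def
      by (subst sum_permutations_compose_right[OF \<rho>], unfold P_def[symmetric])
        (intro sum.cong refl, simp add: f A'A)
  qed
  have S: "S = w X N * contact_sum m b w v"
  proof -
    have "S = sum f {\<sigma>\<in>P. A m \<sigma>}"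
      unfolding S_def by (rule sum.inter_filter[symmetric, OF finP])
    \<comment> \<open>Fixing the last two indices amounts to permuting only the first
      \<open>2 * m + 1\<close>.\<close>
    also have "{\<sigma>\<in>P. A m \<sigma>} = {\<sigma>. \<sigma> permutes {..<2 * m + 1}}"
    proof safe
      fix \<sigma> assume "\<sigma> \<in> P" "A m \<sigma>"
      show "\<sigma> permutes {..<2 * m + 1}"
      proof (rule permutes_superset)
        show "\<sigma> permutes {..<2 * Suc m + 1}" using \<open>\<sigma> \<in> P\<close> by (simp add: P_def)
        fix x assume "x \<in> {..<2 * Suc m + 1} - {..<2 * m + 1}"
        then have "x = 2 * m + 1 \<or> x = 2 * m + 2" by auto
        then show "\<sigma> x = x" using \<open>A m \<sigma>\<close> by (auto simp: A_def)
      qed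
    next
      fix \<sigma> :: "nat \<Rightarrow> nat" assume \<sigma>: "\<sigma> permutes {..<2 * m + 1}"
      show "\<sigma> \<in> P"
        unfolding P_def using permutes_subset[OF \<sigma>] by auto
      show "A m \<sigma>"
        unfolding A_def using permutes_not_in[OF \<sigma>] by auto
    qed
    also have "sum f \<dots> = w X N * contact_sum m b w v"
      unfolding contact_sum_def sum_distrib_left
    proof (intro sum.cong refl)
      fix \<sigma> :: "nat \<Rightarrow> nat" assume "\<sigma> \<in> {\<sigma>. \<sigma> permutes {..<2 * m + 1}}"
      then have "\<sigma> (2 * m + 1) = 2 * m + 1" "\<sigma> (2 * m + 2) = 2 * m + 2"
        using permutes_not_in[of \<sigma>] by auto
      then have "h \<sigma> m = w X N" by (simp add: h_def X_def N_def)
      then show "f \<sigma> = w X N * (of_int (sign \<sigma>) *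
        (b (v (\<sigma> 0)) * (\<Prod>i<m. w (v (\<sigma> (2 * i + 1))) (v (\<sigma> (2 * i + 2))))))"
        by (simp add: f_def) (simp add: h_def)
    qed
    finally show ?thesis .
  qed
  have "contact_sum (Suc m) b w v = sum f P"
    by (simp add: contact_sum_def f_def P_def h_def)
  also have "\<dots> = (\<Sum>\<sigma>\<in>P. \<Sum>i<Suc m. (if A i \<sigma> then f \<sigma> else 0) + (if A' i \<sigma> then f \<sigma> else 0))"
    by (rule sum.cong[OF refl split])
  also have "\<dots> = (\<Sum>i<Suc m. \<Sum>\<sigma>\<in>P. (if A i \<sigma> then f \<sigma> else 0) + (if A' i \<sigma> then f \<sigma> else 0))"
    by (rule sum.swap)
  also have "\<dots> = (\<Sum>i<Suc m. S + S)"
    by (intro sum.cong refl) (simp only: sum.distrib pairs flip lessThan_iff)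
  finally show ?thesis by (simp add: S)
qed

text \<open>Linear algebra at one boundary point: \<open>D\<close> stands for the differential of
  the projection, \<open>H\<close> for the tangent space of the boundary, \<open>l\<close> for a
  linear lift, and \<open>X\<close> spans the vertical line. The lifted basis vectors,
  \<open>X\<close> and \<open>N\<close> span, so the contact sum is nonzero on them; contraction
  then exhibits the reduced contact sum as a factor.\<close>

lemma contact_sum_reduction:
  fixes b :: "'m::euclidean_space \<Rightarrow> real" and br :: "'r::euclidean_space \<Rightarrow> real"
    and D :: "'m \<Rightarrow> 'r"
  assumes dim: "DIM('r) = 2 * m + 1"
    and b: "linear b" and w: "\<And>u. linear (w u)" "\<And>u. linear (\<lambda>x. w x u)"
    and anti: "\<And>x y. w y x = - w x y"
    and br: "linear br" and wr: "\<And>u. linear (wr u)"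
    and l: "linear l" "\<And>z. l z \<in> H" "\<And>z. D (l z) = z"
    and X: "X \<in> H" "D X = 0"
    and H: "\<And>h. h \<in> H \<Longrightarrow> \<exists>c. h = l (D h) + c *\<^sub>R X"
    and N: "\<And>x. \<exists>c. x - c *\<^sub>R N \<in> H"
    and b_eq: "\<And>h. h \<in> H \<Longrightarrow> b h = br (D h)"
    and w_eq: "\<And>h h'. h \<in> H \<Longrightarrow> h' \<in> H \<Longrightarrow> w h h' = wr (D h) (D h')"
    and nz: "contact_sum (Suc m) b w v \<noteq> 0"
  shows "\<exists>u. contact_sum m br wr u \<noteq> 0"
proof -
  obtain f where f: "bij_betw f {..<2 * m + 1} (Basis :: 'r set)"
    using ex_bij_betw_nat_finite[OF finite_Basis] dim by (metis lessThan_atLeast0)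
  \<comment> \<open>\<open>contact_sum_contract\<close> expects \<open>X\<close> at index
    \<open>2 * m + 1\<close> and \<open>N\<close> at index \<open>2 * m + 2\<close>.\<close>
  define e where "e j = (if j < 2 * m + 1 then l (f j) else if j = 2 * m + 1 then X else N)" for j
  let ?E = "e ` {..<2 * Suc m + 1}"
  have "2 * m + 1 < 2 * Suc m + 1" "2 * m + 2 < 2 * Suc m + 1" by simp_all
  moreover have eX: "e (2 * m + 1) = X" and eN: "e (2 * m + 2) = N"
    by (simp_all add: e_def)
  ultimately have XE: "X \<in> ?E" and NE: "N \<in> ?E"
    by (metis imageI lessThan_iff)+
  have "l ` Basis \<subseteq> ?E"
  proof safe
    fix i :: 'r assume "i \<in> Basis"
    then obtain j where "j < 2 * m + 1" "f j = i"
      using f unfolding bij_betw_def by (metis imageE lessThan_iff)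
    then have "l i = e j" "j < 2 * Suc m + 1" by (simp_all add: e_def)
    then show "l i \<in> ?E" by blast
  qed
  then have "span (l ` Basis) \<subseteq> span ?E" by (rule span_mono)
  moreover have "span (l ` Basis) = range l"
    using linear_span_image[OF l(1), of Basis] by simp
  ultimately have lE: "l z \<in> span ?E" for z by blast
  have "x \<in> span ?E" for x
  proof -
    obtain c where "x - c *\<^sub>R N \<in> H" using N by blast
    then obtain c' where "x - c *\<^sub>R N = l (D (x - c *\<^sub>R N)) + c' *\<^sub>R X" using H by blast
    then have "x = l (D (x - c *\<^sub>R N)) + c' *\<^sub>R X + c *\<^sub>R N" by (simp add: algebra_simps)
    moreover have "l (D (x - c *\<^sub>R N)) + c' *\<^sub>R X + c *\<^sub>R N \<in> span ?E"
      by (intro span_add span_scale lE span_base[OF XE] span_base[OF NE])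
    ultimately show ?thesis by simp
  qed
  then have "span ?E = UNIV" by blast
  then have "contact_sum (Suc m) b w e \<noteq> 0"
    using contact_sum_eq_0_if_0_on_spanning[OF b w] nz by blast
  moreover have "contact_sum (Suc m) b w e = 2 * real (Suc m) * w X N * contact_sum m b w e"
  proof -
    \<comment> \<open>\<open>X\<close> is vertical, so \<open>w h X = wr (D h) 0 = 0\<close>;
      antisymmetry gives the other order.\<close>
    have "w h X = 0" "w X h = 0" if "h \<in> H" for h
      using that anti[of X h] w_eq[OF that X(1)] X(2) linear_0[OF wr] by simp_all
    moreover have "e j \<in> H" if "j < 2 * m + 1" for j
      using that l(2) by (simp add: e_def)
    moreover have "b X = 0"
      using b_eq[OF X(1)] X(2) linear_0[OF br] by simp
    ultimately show ?thesis
      by (intro contact_sum_contract[of b e m w, unfolded eX eN]) (simp_all add: anti[symmetric])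
  qed
  moreover have "contact_sum m b w e = contact_sum m br wr f"
    using l by (intro contact_sum_cong) (simp_all add: e_def b_eq w_eq)
  ultimately show ?thesis by auto
qed

section \<open>Derivatives along curves and pullbacks of exterior derivatives\<close>

text \<open>Within a thin set the derivative is not unique, but the chain rule along a curve in the
  set holds for every choice. Membership on both sides of 0 makes the derivative of the composition
  an ordinary, hence unique, one.\<close>

lemma has_vector_derivative_frechet_within_curve:
  assumes f: "f differentiable (at x within S)" and c: "(c has_vector_derivative v) (at 0)"
    and "c 0 = x" and S: "\<forall>\<^sub>F t in nhds 0. c t \<in> S"
  shows "((\<lambda>t. f (c t)) has_vector_derivative frechet_derivative f (at x within S) v) (at 0)"
proof -
  obtain T where T: "open T" "0 \<in> T" "\<And>t. t \<in> T \<Longrightarrow> c t \<in> S"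
    using S unfolding eventually_nhds by blast
  have "(c has_derivative (\<lambda>t. t *\<^sub>R v)) (at 0 within T)"
    using c by (simp add: has_vector_derivative_def has_derivative_at_withinI)
  moreover have "(f has_derivative frechet_derivative f (at x within S)) (at (c 0) within c ` T)"
    using f T(3) unfolding \<open>c 0 = x\<close> by (metis frechet_derivative_works has_derivative_subset image_subsetI)
  ultimately have "(f \<circ> c has_derivative frechet_derivative f (at x within S) \<circ> (\<lambda>t. t *\<^sub>R v)) (at 0 within T)"
    by (rule diff_chain_within)
  moreover have "linear (frechet_derivative f (at x within S))"
    using f frechet_derivative_works has_derivative_linear by blast
  ultimately show ?thesis
    using T at_within_open[of 0 T] by (simp add: has_vector_derivative_def o_def linear_cmul)
qed

lemma has_vector_derivative_line: "((\<lambda>t. x + t *\<^sub>R v) has_vector_derivative v) (at 0)"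
proof -
  have "((\<lambda>t. x + t *\<^sub>R v) has_derivative (\<lambda>h. h *\<^sub>R v)) (at 0)"
    by (auto intro!: derivative_eq_intros)
  then show ?thesis by (simp only: has_vector_derivative_def)
qed

text \<open>The mean value theorem is applied twice to the second difference over the parallelogram
  spanned by \<open>t *\<^sub>R u\<close> and \<open>t *\<^sub>R v\<close>, an expression symmetric
  in \<open>u\<close> and \<open>v\<close>.\<close>

lemma symmetric_second_derivative_aux:
  fixes f :: "'a::real_normed_vector \<Rightarrow> real"
  assumes r: "ball x r \<subseteq> W" and t: "0 < t" "t * (norm u + norm v) < r"
    and D: "\<And>y. y \<in> W \<Longrightarrow> (f has_derivative D y) (at y)"
    and E: "\<And>y. y \<in> W \<Longrightarrow> ((\<lambda>y. D y u) has_derivative E y) (at y)"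
  shows "\<exists>y. norm (y - x) \<le> t * (norm u + norm v) \<and>
    f (x + t *\<^sub>R u + t *\<^sub>R v) - f (x + t *\<^sub>R u) - f (x + t *\<^sub>R v) + f x = t * t * E y v"
proof -
  have small: "norm ((x + s *\<^sub>R u + s' *\<^sub>R v) - x) \<le> t * (norm u + norm v)"
    if "0 \<le> s" "s \<le> t" "0 \<le> s'" "s' \<le> t" for s s'
  proof -
    have "norm ((x + s *\<^sub>R u + s' *\<^sub>R v) - x) \<le> s * norm u + s' * norm v"
      using norm_triangle_ineq[of "s *\<^sub>R u" "s' *\<^sub>R v"] that by simp
    also have "\<dots> \<le> t * norm u + t * norm v"
      using that by (intro add_mono mult_right_mono) auto
    finally show ?thesis by (simp add: algebra_simps)
  qed
  have W: "x + s *\<^sub>R u + s' *\<^sub>R v \<in> W"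
    if "0 \<le> s" "s \<le> t" "0 \<le> s'" "s' \<le> t" for s s'
    using small[OF that] t(2) r by (auto simp: dist_norm norm_minus_commute subset_iff)
  have "\<exists>\<xi>. 0 < \<xi> \<and> \<xi> < t \<and> (f (x + t *\<^sub>R u + t *\<^sub>R v) - f (x + t *\<^sub>R u + 0 *\<^sub>R v)) -
      (f (x + 0 *\<^sub>R u + t *\<^sub>R v) - f (x + 0 *\<^sub>R u + 0 *\<^sub>R v)) =
      (t - 0) * (D (x + \<xi> *\<^sub>R u + t *\<^sub>R v) u - D (x + \<xi> *\<^sub>R u + 0 *\<^sub>R v) u)"
  proof (rule MVT2[OF t(1)])
    fix s assume s: "0 \<le> s" "s \<le> t"
    have "((\<lambda>s. f (x + s *\<^sub>R u + s' *\<^sub>R v)) has_real_derivative D (x + s *\<^sub>R u + s' *\<^sub>R v) u) (at s)"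
      if "0 \<le> s'" "s' \<le> t" for s'
    proof -
      note d = D[OF W[OF s that]]
      have "((\<lambda>s. x + s *\<^sub>R u + s' *\<^sub>R v) has_derivative (\<lambda>h. h *\<^sub>R u)) (at s)"
        by (auto intro!: derivative_eq_intros)
      from diff_chain_at[OF this, of f, OF d]
      show ?thesis
        unfolding o_def
        by (rule has_derivative_imp_has_field_derivative)
          (simp add: linear_cmul[OF has_derivative_linear[OF d]])
    qed
    from DERIV_diff[OF this[of t] this[of 0]] show "((\<lambda>s. f (x + s *\<^sub>R u + t *\<^sub>R v) - f (x + s *\<^sub>R u + 0 *\<^sub>R v)) has_real_derivative
       D (x + s *\<^sub>R u + t *\<^sub>R v) u - D (x + s *\<^sub>R u + 0 *\<^sub>R v) u) (at s)"
      using t(1) by simp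
  qed
  then obtain \<xi> where \<xi>: "0 < \<xi>" "\<xi> < t"
    "f (x + t *\<^sub>R u + t *\<^sub>R v) - f (x + t *\<^sub>R u) - f (x + t *\<^sub>R v) + f x =
      t * (D (x + \<xi> *\<^sub>R u + t *\<^sub>R v) u - D (x + \<xi> *\<^sub>R u + 0 *\<^sub>R v) u)"
    by (auto simp: algebra_simps)
  have "\<exists>\<eta>. 0 < \<eta> \<and> \<eta> < t \<and> D (x + \<xi> *\<^sub>R u + t *\<^sub>R v) u - D (x + \<xi> *\<^sub>R u + 0 *\<^sub>R v) u =
      (t - 0) * E (x + \<xi> *\<^sub>R u + \<eta> *\<^sub>R v) v"
  proof (rule MVT2[OF t(1)])
    fix s assume s: "0 \<le> s" "s \<le> t"
    have d: "((\<lambda>y. D y u) has_derivative E (x + \<xi> *\<^sub>R u + s *\<^sub>R v)) (at (x + \<xi> *\<^sub>R u + s *\<^sub>R v))"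
      using \<xi>(1,2) s by (intro E W) simp_all
    have "((\<lambda>s. x + \<xi> *\<^sub>R u + s *\<^sub>R v) has_derivative (\<lambda>h. h *\<^sub>R v)) (at s)"
      by (auto intro!: derivative_eq_intros)
    from diff_chain_at[OF this, of "\<lambda>y. D y u", OF d]
    show "((\<lambda>s. D (x + \<xi> *\<^sub>R u + s *\<^sub>R v) u) has_real_derivative E (x + \<xi> *\<^sub>R u + s *\<^sub>R v) v) (at s)"
      unfolding o_def
      by (rule has_derivative_imp_has_field_derivative)
        (simp add: linear_cmul[OF has_derivative_linear[OF d]])
  qed
  then obtain \<eta> where "0 < \<eta>" "\<eta> < t" "D (x + \<xi> *\<^sub>R u + t *\<^sub>R v) u - D (x + \<xi> *\<^sub>R u + 0 *\<^sub>R v) u =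
      t * E (x + \<xi> *\<^sub>R u + \<eta> *\<^sub>R v) v" by auto
  then show ?thesis
    using \<xi> small[of \<xi> \<eta>] by (intro exI[of _ "x + \<xi> *\<^sub>R u + \<eta> *\<^sub>R v"]) simp
qed

text \<open>Both mixed derivatives, taken at points close to \<open>x\<close>, equal the same second
  difference divided by \<open>t * t\<close>; continuity at \<open>x\<close> identifies
  them.\<close>

lemma symmetric_second_derivative:
  fixes f :: "'a::real_normed_vector \<Rightarrow> real"
  assumes W: "open W" "x \<in> W"
    and D: "\<And>y. y \<in> W \<Longrightarrow> (f has_derivative D y) (at y)"
    and E: "\<And>y. y \<in> W \<Longrightarrow> ((\<lambda>y. D y u) has_derivative E y) (at y)"
    and F: "\<And>y. y \<in> W \<Longrightarrow> ((\<lambda>y. D y v) has_derivative F y) (at y)"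
    and cont: "isCont (\<lambda>y. E y v) x" "isCont (\<lambda>y. F y u) x"
  shows "E x v = F x u"
proof (rule ccontr)
  assume "E x v \<noteq> F x u"
  define d where "d = \<bar>E x v - F x u\<bar> / 2"
  have "0 < d" using \<open>E x v \<noteq> F x u\<close> by (simp add: d_def)
  obtain r where r: "0 < r" "ball x r \<subseteq> W" using W open_contains_ball by blast
  obtain s1 where s1: "0 < s1" "\<And>y. dist y x < s1 \<Longrightarrow> dist (E y v) (E x v) < d"
    using cont(1) \<open>0 < d\<close> unfolding continuous_at_eps_delta by blast
  obtain s2 where s2: "0 < s2" "\<And>y. dist y x < s2 \<Longrightarrow> dist (F y u) (F x u) < d"
    using cont(2) \<open>0 < d\<close> unfolding continuous_at_eps_delta by blast
  define q where "q = min r (min s1 s2)"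
  \<comment> \<open>The summand 1 keeps the denominator positive if \<open>u\<close> and
    \<open>v\<close> vanish, and makes the parallelogram fit strictly into the ball of radius
    \<open>q\<close>.\<close>
  define t where "t = q / (norm u + norm v + 1)"
  have "0 < q" using r s1 s2 by (simp add: q_def)
  have n: "0 < norm u + norm v + 1" by (simp add: add_nonneg_pos)
  then have t: "0 < t" using \<open>0 < q\<close> by (simp add: t_def)
  have "t * (norm u + norm v + 1) = q" using n by (simp add: t_def)
  then have tq: "t * (norm u + norm v) < q" using t by (simp add: algebra_simps)
  have tr: "t * (norm u + norm v) < r" using tq by (simp add: q_def)
  obtain y where y: "norm (y - x) \<le> t * (norm u + norm v)"
    "f (x + t *\<^sub>R u + t *\<^sub>R v) - f (x + t *\<^sub>R u) - f (x + t *\<^sub>R v) + f x = t * t * E y v"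
    using symmetric_second_derivative_aux[OF r(2) t tr D E] by blast
  have tr': "t * (norm v + norm u) < r" using tr by (simp add: add.commute)
  obtain z where z: "norm (z - x) \<le> t * (norm v + norm u)"
    "f (x + t *\<^sub>R v + t *\<^sub>R u) - f (x + t *\<^sub>R v) - f (x + t *\<^sub>R u) + f x = t * t * F z u"
    using symmetric_second_derivative_aux[OF r(2) t tr' D F] by blast
  have "x + t *\<^sub>R v + t *\<^sub>R u = x + t *\<^sub>R u + t *\<^sub>R v" by simp
  from y(2) z(2)[unfolded this] have "t * t * E y v = t * t * F z u" by linarith
  then have "E y v = F z u" using t by simp
  moreover have "dist y x < s1" "dist z x < s2"
    using y(1) z(1) tq by (auto simp: dist_norm q_def add.commute)
  then have "dist (E y v) (E x v) < d" "dist (F z u) (F x u) < d"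
    using s1(2) s2(2) by blast+
  ultimately have "\<bar>E x v - F x u\<bar> < 2 * d" by (simp add: dist_real_def)
  then show False by (simp add: d_def)
qed

section \<open>Derivatives of maps that are smooth on an open set\<close>

lemma C_k_on_all_derivative:
  assumes "\<forall>k. C_k_on k W g"
  shows "\<forall>k. C_k_on k W (\<lambda>x. frechet_derivative g (at x) v)"
proof
  fix k
  have "C_k_on (Suc k) W g" using assms by blast
  then show "C_k_on k W (\<lambda>x. frechet_derivative g (at x) v)" unfolding C_k_on.simps by blast
qed

lemma C_k_on_all_has_derivative:
  assumes "\<forall>k. C_k_on k W g" "x \<in> W"
  shows "(g has_derivative frechet_derivative g (at x)) (at x)"
proof -
  have "C_k_on (Suc 0) W g" using assms by blast
  then show ?thesis using assms(2) unfolding C_k_on.simps frechet_derivative_works by blast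
qed

lemma C_k_on_all_isCont:
  assumes "\<forall>k. C_k_on k W g" "open W" "x \<in> W"
  shows "isCont g x"
proof -
  have "C_k_on 0 W g" using assms by blast
  then show ?thesis using assms(2,3) continuous_on_eq_continuous_at by auto
qed

lemma C_k_on_all_second_derivative_symmetric:
  fixes g :: "'a::euclidean_space \<Rightarrow> 'b::euclidean_space"
  assumes g: "\<forall>k. C_k_on k W g" and W: "open W" "x \<in> W"
  shows "frechet_derivative (\<lambda>y. frechet_derivative g (at y) u) (at x) v =
    frechet_derivative (\<lambda>y. frechet_derivative g (at y) v) (at x) u"
proof (rule euclidean_eqI)
  fix b :: 'b
  let ?D = "\<lambda>y. frechet_derivative g (at y)"
  let ?E = "\<lambda>u y. frechet_derivative (\<lambda>y. ?D y u) (at y)"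
  have smooth1: "\<forall>k. C_k_on k W (\<lambda>y. ?D y u)" for u
    by (rule C_k_on_all_derivative[OF g])
  have cont: "isCont (\<lambda>y. ?E u y v \<bullet> b) x" for u v
    by (intro continuous_intros C_k_on_all_isCont[OF C_k_on_all_derivative[OF smooth1] W])
  show "?E u x v \<bullet> b = ?E v x u \<bullet> b"
    by (rule symmetric_second_derivative[OF W, where f = "\<lambda>y. g y \<bullet> b" and D = "\<lambda>y h. ?D y h \<bullet> b"
        and E = "\<lambda>y h. ?E u y h \<bullet> b" and F = "\<lambda>y h. ?E v y h \<bullet> b"])
      (auto intro!: has_derivative_inner_left C_k_on_all_has_derivative[OF g]
        C_k_on_all_has_derivative[OF smooth1] cont)
qed

text \<open>A product rule in which base point and vector both move. Expanding the vector in the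
  basis reduces it to the functions of \<open>y\<close> with a fixed vector, whose differentiability
  is what is assumed.\<close>

lemma has_vector_derivative_form_along_curve:
  fixes \<rho> :: "'r::euclidean_space \<Rightarrow> 'r \<Rightarrow> real"
  assumes R: "open R" "z 0 \<in> R" and lin: "\<And>y. y \<in> R \<Longrightarrow> linear (\<rho> y)"
    and diff: "\<And>b. (\<lambda>y. \<rho> y b) differentiable (at (z 0))"
    and z: "(z has_vector_derivative z') (at 0)" and w: "(w has_vector_derivative w') (at 0)"
  shows "((\<lambda>t. \<rho> (z t) (w t)) has_vector_derivative
    \<rho> (z 0) w' + frechet_derivative (\<lambda>y. \<rho> y (w 0)) (at (z 0)) z') (at 0)"
proof -
  have expand: "\<rho> y u = (\<Sum>b\<in>Basis. (u \<bullet> b) * \<rho> y b)" if "y \<in> R" for y u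
  proof -
    have "\<rho> y u = \<rho> y (\<Sum>b\<in>Basis. (u \<bullet> b) *\<^sub>R b)" by (simp add: euclidean_representation)
    then show ?thesis
      using lin[OF that] by (simp only: linear_sum linear_cmul real_scaleR_def)
  qed
  let ?D = "\<lambda>b. frechet_derivative (\<lambda>y. \<rho> y b) (at (z 0))"
  have D: "((\<lambda>y. \<rho> y b) has_derivative ?D b) (at (z 0))" for b
    using diff by (simp add: frechet_derivative_works)
  have "((\<lambda>y. \<Sum>b\<in>Basis. (w 0 \<bullet> b) * \<rho> y b) has_derivative
      (\<lambda>h. \<Sum>b\<in>Basis. (w 0 \<bullet> b) * ?D b h)) (at (z 0))"
    by (intro derivative_intros D)
  then have "((\<lambda>y. \<rho> y (w 0)) has_derivative (\<lambda>h. \<Sum>b\<in>Basis. (w 0 \<bullet> b) * ?D b h)) (at (z 0))"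
    by (rule has_derivative_transform_within_open[OF _ R]) (simp add: expand)
  then have Dw: "?D (w 0) z' = (\<Sum>b\<in>Basis. (w 0 \<bullet> b) * ?D b z')"
    by (simp add: frechet_derivative_at[symmetric])
  have "isCont z 0" using z has_vector_derivative_continuous by blast
  then have "\<forall>\<^sub>F t in nhds 0. z t \<in> R"
    using R by (auto simp: continuous_at eventually_nhds_conv_at dest: topological_tendstoD)
  then obtain T where T: "open T" "0 \<in> T" "\<And>t. t \<in> T \<Longrightarrow> z t \<in> R"
    unfolding eventually_nhds by blast
  have "((\<lambda>t. \<rho> (z t) b) has_vector_derivative ?D b z') (at 0)" for b
    using has_vector_derivative_frechet_within_curve[OF diff z refl] by simp
  moreover have "((\<lambda>t. w t \<bullet> b) has_vector_derivative w' \<bullet> b) (at 0)" for b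
    by (rule bounded_linear.has_vector_derivative[OF bounded_linear_inner_left w])
  ultimately have "((\<lambda>t. \<Sum>b\<in>Basis. (w t \<bullet> b) * \<rho> (z t) b) has_vector_derivative
     (\<Sum>b\<in>Basis. (w 0 \<bullet> b) * ?D b z' + (w' \<bullet> b) * \<rho> (z 0) b)) (at 0)"
    by (intro has_vector_derivative_sum has_vector_derivative_mult)
  then have "((\<lambda>t. \<rho> (z t) (w t)) has_vector_derivative
     (\<Sum>b\<in>Basis. (w 0 \<bullet> b) * ?D b z' + (w' \<bullet> b) * \<rho> (z 0) b)) (at 0)"
    using T by (elim has_vector_derivative_transform_within_open) (auto simp: expand)
  moreover have "(\<Sum>b\<in>Basis. (w 0 \<bullet> b) * ?D b z' + (w' \<bullet> b) * \<rho> (z 0) b) =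
      \<rho> (z 0) w' + ?D (w 0) z'"
    unfolding Dw expand[OF R(2), of w'] by (simp add: sum.distrib add.commute)
  ultimately show ?thesis by simp
qed

lemma has_vector_derivative_frechet_line:
  assumes "f differentiable (at x)"
  shows "((\<lambda>t. f (x + t *\<^sub>R v)) has_vector_derivative frechet_derivative f (at x) v) (at 0)"
  by (rule has_vector_derivative_frechet_within_curve[OF _ has_vector_derivative_line]) (use assms in auto)

text \<open>\<open>\<beta>\<close> is known to be the pullback of \<open>\<rho>\<close> only at
  points of \<open>Q\<close> and on vectors of \<open>H\<close>, so it is differentiated along lines
  that stay in \<open>S \<inter> Q\<close>. Each directional derivative contains a second derivative
  of \<open>G\<close>, which cancels in the difference by symmetry.\<close>

lemma ext_deriv_pullback:
  fixes \<beta> :: "'m::euclidean_space \<Rightarrow> 'm \<Rightarrow> real" and \<rho> :: "'r::euclidean_space \<Rightarrow> 'r \<Rightarrow> real"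
  assumes G: "\<forall>k. C_k_on k W G" "open W" "x \<in> W"
    and R: "open R" "G x \<in> R" "\<And>y. y \<in> R \<Longrightarrow> linear (\<rho> y)"
    and \<beta>: "\<And>v. (\<lambda>y. \<beta> y v) differentiable (at x within S)"
    and \<rho>: "\<And>v. (\<lambda>y. \<rho> y v) differentiable (at (G x))"
    and ev: "\<And>h. h \<in> H \<Longrightarrow> \<forall>\<^sub>F t in nhds 0. x + t *\<^sub>R h \<in> S \<inter> Q"
    and eq: "\<And>y h. y \<in> Q \<Longrightarrow> h \<in> H \<Longrightarrow> \<beta> y h = \<rho> (G y) (frechet_derivative G (at y) h)"
    and h: "h1 \<in> H" "h2 \<in> H"
  defines "D \<equiv> frechet_derivative G (at x)"
  shows "frechet_derivative (\<lambda>y. \<beta> y h2) (at x within S) h1 -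
      frechet_derivative (\<lambda>y. \<beta> y h1) (at x within S) h2 =
    frechet_derivative (\<lambda>y. \<rho> y (D h2)) (at (G x)) (D h1) -
      frechet_derivative (\<lambda>y. \<rho> y (D h1)) (at (G x)) (D h2)"
proof -
  let ?D2 = "\<lambda>u v. frechet_derivative (\<lambda>y. frechet_derivative G (at y) u) (at x) v"
  have *: "frechet_derivative (\<lambda>y. \<beta> y v) (at x within S) u =
      \<rho> (G x) (?D2 v u) + frechet_derivative (\<lambda>y. \<rho> y (D v)) (at (G x)) (D u)"
    if "u \<in> H" "v \<in> H" for u v
  proof -
    have evu: "\<forall>\<^sub>F t in nhds 0. x + t *\<^sub>R u \<in> S \<inter> Q"
      using ev[OF that(1)] .
    have curve: "((\<lambda>t. g (x + t *\<^sub>R u)) has_vector_derivative frechet_derivative g (at x) u) (at 0)"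
      if "\<forall>k. C_k_on k W g" for g :: "'m \<Rightarrow> 'c::euclidean_space"
      using C_k_on_all_has_derivative[OF that G(3)]
      by (intro has_vector_derivative_frechet_line) (auto simp: differentiable_def)
    have "((\<lambda>t. \<rho> (G (x + t *\<^sub>R u)) (frechet_derivative G (at (x + t *\<^sub>R u)) v)) has_vector_derivative
        \<rho> (G x) (?D2 v u) + frechet_derivative (\<lambda>y. \<rho> y (D v)) (at (G x)) (D u)) (at 0)"
      using has_vector_derivative_form_along_curve[where \<rho> = \<rho>, OF R(1) _ R(3) _ curve[OF G(1)]
          curve[OF C_k_on_all_derivative[OF G(1)], of v]] R(2) \<rho>
      by (simp add: D_def)
    moreover obtain T where T: "open T" "0 \<in> T" "\<And>t. t \<in> T \<Longrightarrow> x + t *\<^sub>R u \<in> S \<inter> Q"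
      using evu unfolding eventually_nhds by blast
    ultimately have "((\<lambda>t. \<beta> (x + t *\<^sub>R u) v) has_vector_derivative
        \<rho> (G x) (?D2 v u) + frechet_derivative (\<lambda>y. \<rho> y (D v)) (at (G x)) (D u)) (at 0)"
      by (elim has_vector_derivative_transform_within_open[OF _ T(1,2)]) (use eq that T(3) in auto)
    moreover have "((\<lambda>t. \<beta> (x + t *\<^sub>R u) v) has_vector_derivative
        frechet_derivative (\<lambda>y. \<beta> y v) (at x within S) u) (at 0)"
      using evu
      by (intro has_vector_derivative_frechet_within_curve[OF \<beta> has_vector_derivative_line])
        (auto elim: eventually_mono)
    ultimately show ?thesis
      using vector_derivative_unique_at by blast
  qed
  show ?thesis
    unfolding *[OF h] *[OF h(2,1)]
    using C_k_on_all_second_derivative_symmetric[OF G, of h1 h2] by simp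
qed

section \<open>Smoothness on arbitrary sets and curves near a point\<close>

lemma smooth_on_subset: "smooth_on S f \<Longrightarrow> T \<subseteq> S \<Longrightarrow> smooth_on T f"
proof (unfold smooth_on_def, rule ballI)
  fix x assume "\<forall>x\<in>S. \<exists>W g. open W \<and> x \<in> W \<and> (\<forall>k. C_k_on k W g) \<and> (\<forall>y\<in>S \<inter> W. g y = f y)"
    and "T \<subseteq> S" "x \<in> T"
  then obtain W g where "open W" "x \<in> W" "\<forall>k. C_k_on k W g" "\<forall>y\<in>S \<inter> W. g y = f y" by (meson subsetD)
  moreover from this(4) have "\<forall>y\<in>T \<inter> W. g y = f y" using \<open>T \<subseteq> S\<close> by blast
  ultimately show "\<exists>W g. open W \<and> x \<in> W \<and> (\<forall>k. C_k_on k W g) \<and> (\<forall>y\<in>T \<inter> W. g y = f y)" by blast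
qed

lemma smooth_on_cong:
  assumes "smooth_on S f" "\<And>x. x \<in> S \<Longrightarrow> f x = g x"
  shows "smooth_on S g"
proof -
  have "(\<forall>y\<in>S \<inter> W. h y = f y) \<longleftrightarrow> (\<forall>y\<in>S \<inter> W. h y = g y)" for W h
    using assms(2) by (intro ball_cong) auto
  then show ?thesis using assms(1) unfolding smooth_on_def by simp
qed

lemma smooth_on_differentiable_within:
  assumes "smooth_on S f" "x \<in> S"
  shows "f differentiable (at x within S)"
proof -
  obtain W g where W: "open W" "x \<in> W" "\<forall>k. C_k_on k W g" "\<forall>y\<in>S \<inter> W. g y = f y"
    using bspec[OF assms[unfolded smooth_on_def]] by (elim exE conjE)
  then obtain r where "0 < r" "ball x r \<subseteq> W" using open_contains_ball by blast
  moreover have "g differentiable (at x within S)"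
    using C_k_on_all_has_derivative[OF W(3,2)] has_derivative_at_withinI
    unfolding differentiable_def by blast
  ultimately show ?thesis
    using assms(2) W(4) by (elim differentiable_transform_within) (auto simp: dist_commute subset_iff)
qed

lemma smooth_on_has_vector_derivative_curve:
  assumes "smooth_on S f" "(c has_vector_derivative v) (at 0)" "\<forall>\<^sub>F t in nhds 0. c t \<in> S"
  shows "((\<lambda>t. f (c t)) has_vector_derivative frechet_derivative f (at (c 0) within S) v) (at 0)"
proof -
  have "c 0 \<in> S" using assms(3) eventually_nhds_x_imp_x by blast
  then show ?thesis
    using assms smooth_on_differentiable_within
    by (intro has_vector_derivative_frechet_within_curve) auto
qed

lemma has_vector_derivative_cong_eventually:
  assumes "(f has_vector_derivative d) (at 0)" "\<forall>\<^sub>F t in nhds 0. f t = g t"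
  shows "(g has_vector_derivative d) (at 0)"
proof -
  obtain T where "open T" "0 \<in> T" "\<And>t. t \<in> T \<Longrightarrow> f t = g t"
    using assms(2) unfolding eventually_nhds by blast
  then show ?thesis
    using assms(1) has_vector_derivative_transform_within_open by blast
qed

lemma has_vector_derivative_unique_eventually:
  assumes "(f has_vector_derivative u) (at 0)" "(g has_vector_derivative v) (at 0)"
    "\<forall>\<^sub>F t in nhds 0. f t = g t"
  shows "u = v"
  using has_vector_derivative_cong_eventually[OF assms(1,3)] assms(2) vector_derivative_unique_at by blast

lemma eventually_nhds_continuous_openin:
  assumes "openin (top_of_set K) A" "c 0 \<in> A" "isCont c 0" "\<forall>\<^sub>F t in nhds 0. c t \<in> K"
  shows "\<forall>\<^sub>F t in nhds 0. c t \<in> A"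
proof -
  obtain T where T: "open T" "A = K \<inter> T" using assms(1) by (auto simp: openin_open)
  then have "\<forall>\<^sub>F t in nhds 0. c t \<in> T"
    using assms(2,3) by (auto simp: continuous_at eventually_nhds_conv_at dest: topological_tendstoD)
  then show ?thesis using assms(4) by eventually_elim (simp add: T(2))
qed

section \<open>Charts and the boundary\<close>

lemma smooth_atlasD:
  assumes "smooth_atlas K M" "(U, \<phi>) \<in> atlas M"
  shows "openin (mspace M) U" "openin (top_of_set K) (\<phi> ` U)"
    "homeomorphic_map (subtopology (mspace M) U) (top_of_set (\<phi> ` U)) \<phi>" "inj_on \<phi> U"
    "(V, \<psi>) \<in> atlas M \<Longrightarrow> smooth_on (\<phi> ` (U \<inter> V)) (\<psi> \<circ> inv_into U \<phi>)"
proof -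
  show U: "openin (mspace M) U" and "openin (top_of_set K) (\<phi> ` U)"
    and h: "homeomorphic_map (subtopology (mspace M) U) (top_of_set (\<phi> ` U)) \<phi>"
    using assms unfolding smooth_atlas_def by blast+
  have "\<forall>(U, \<phi>)\<in>atlas M. \<forall>(V, \<psi>)\<in>atlas M. smooth_on (\<phi> ` (U \<inter> V)) (\<psi> \<circ> inv_into U \<phi>)"
    using assms(1) unfolding smooth_atlas_def by (elim conjE)
  note transitions = bspec[OF this assms(2), unfolded case_prod_conv]
  show "(V, \<psi>) \<in> atlas M \<Longrightarrow> smooth_on (\<phi> ` (U \<inter> V)) (\<psi> \<circ> inv_into U \<phi>)"
    using bspec[OF transitions, of "(V, \<psi>)"] by simp
  show "inj_on \<phi> U"
    using homeomorphic_imp_injective_map[OF h] openin_subset[OF U] by (simp add: inf.absorb2)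
qed

lemma chart_image_open:
  assumes M: "smooth_atlas K M" "(U, \<phi>) \<in> atlas M" and A: "openin (mspace M) A"
  shows "openin (top_of_set K) (\<phi> ` (U \<inter> A))"
proof -
  note U = smooth_atlasD[OF M]
  have "openin (subtopology (mspace M) U) (U \<inter> A)"
    using A by (simp add: openin_subtopology_Int2)
  then have "openin (top_of_set (\<phi> ` U)) (\<phi> ` (U \<inter> A))"
    using homeomorphic_imp_open_map[OF U(3)] unfolding open_map_def by blast
  then show ?thesis using U(2) openin_trans by blast
qed

lemma chart_preimage_open:
  assumes "smooth_atlas K P" "(U, \<phi>) \<in> atlas P" "continuous_map (mspace P) Y f" "openin Y V"
  shows "openin (top_of_set K) (\<phi> ` (U \<inter> f -` V))"
proof -
  have "openin (mspace P) {p \<in> points P. f p \<in> V}"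
    using assms(3,4) by (rule openin_continuous_map_preimage)
  from chart_image_open[OF assms(1,2) this]
  have "openin (top_of_set K) (\<phi> ` (U \<inter> {p \<in> points P. f p \<in> V}))" .
  also have "U \<inter> {p \<in> points P. f p \<in> V} = U \<inter> f -` V"
    using openin_subset[OF smooth_atlasD(1)[OF assms(1,2)]] by auto
  finally show ?thesis .
qed

lemma inv_into_subset_eq:
  assumes "inj_on \<phi> U" "A \<subseteq> U" "x \<in> \<phi> ` A"
  shows "inv_into A \<phi> x = inv_into U \<phi> x"
proof -
  obtain a where "a \<in> A" "x = \<phi> a" using assms(3) by blast
  then show ?thesis
    using assms(1,2) inj_on_subset[OF assms(1,2)] by (metis inv_into_f_f subsetD)
qed

text \<open>The model set may change from \<open>K\<close> to \<open>K'\<close>, which covers both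
  the boundary, modelled on the hyperplane, and open pieces of it.\<close>

lemma smooth_atlas_submfld:
  assumes M: "smooth_atlas K M" and A: "A \<subseteq> points M"
    and op: "\<And>U \<phi>. (U, \<phi>) \<in> atlas M \<Longrightarrow> openin (top_of_set K') (\<phi> ` (U \<inter> A))"
  shows "smooth_atlas K' (submfld M A)"
proof -
  let ?X = "subtopology (mspace M) A"
  have charts: "openin ?X (U \<inter> A) \<and> openin (top_of_set K') (\<phi> ` (U \<inter> A)) \<and>
      homeomorphic_map (subtopology ?X (U \<inter> A)) (top_of_set (\<phi> ` (U \<inter> A))) \<phi>"
    if U: "(U, \<phi>) \<in> atlas M" for U \<phi>
  proof (intro conjI op[OF U])
    note U' = smooth_atlasD[OF M U]
    show "openin ?X (U \<inter> A)"
      using U'(1) by (simp add: openin_subtopology_Int)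
    have "homeomorphic_map (subtopology (subtopology (mspace M) U) (U \<inter> A))
        (subtopology (top_of_set (\<phi> ` U)) (\<phi> ` (U \<inter> A))) \<phi>"
      using openin_subset[OF U'(1)] inj_onD[OF U'(4)]
      by (intro homeomorphic_map_subtopologies[OF U'(3)]) auto
    then show "homeomorphic_map (subtopology ?X (U \<inter> A)) (top_of_set (\<phi> ` (U \<inter> A))) \<phi>"
      by (simp add: subtopology_subtopology inf.absorb2 Int_ac image_mono)
  qed
  have trans: "smooth_on (\<phi> ` (U \<inter> A \<inter> (V \<inter> A))) (\<psi> \<circ> inv_into (U \<inter> A) \<phi>)"
    if U: "(U, \<phi>) \<in> atlas M" and V: "(V, \<psi>) \<in> atlas M" for U \<phi> V \<psi>
  proof (rule smooth_on_cong[OF smooth_on_subset])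
    show "smooth_on (\<phi> ` (U \<inter> V)) (\<psi> \<circ> inv_into U \<phi>)"
      using smooth_atlasD(5)[OF M U V] .
    fix x assume "x \<in> \<phi> ` (U \<inter> A \<inter> (V \<inter> A))"
    then have "inv_into (U \<inter> A) \<phi> x = inv_into U \<phi> x"
      using inv_into_subset_eq[OF smooth_atlasD(4)[OF M U], of "U \<inter> A"] by blast
    then show "(\<psi> \<circ> inv_into U \<phi>) x = (\<psi> \<circ> inv_into (U \<inter> A) \<phi>) x"
      by simp
  qed auto
  have "(\<Union>(U, \<phi>)\<in>atlas M. U) = points M" using M by (simp add: smooth_atlas_def)
  then have "(\<Union>(U, \<phi>)\<in>atlas M. U \<inter> A) = points M \<inter> A" by auto
  then show ?thesis
    unfolding smooth_atlas_def submfld_def using charts trans by (auto simp: case_prod_unfold)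
qed

text \<open>This removes the two choices in \<open>pullback\<close>, the chart around
  \<open>f p\<close> and the derivative within a possibly thin set. Along the curve, the velocity in
  the chosen chart is the image of \<open>d\<close> under the transition map, and the local
  representatives of \<open>\<gamma>\<close> are compatible with transition maps.\<close>

lemma pullback_eq_along_curve:
  assumes N: "smooth_atlas K N" "one_form N \<gamma>"
    and P: "inj_on \<phi> U" "p \<in> U"
      "\<And>V \<psi>. (V, \<psi>) \<in> atlas N \<Longrightarrow> smooth_on (\<phi> ` (U \<inter> f -` V)) (\<psi> \<circ> f \<circ> inv_into U \<phi>)"
    and c: "(c has_vector_derivative v) (at 0)" "c 0 = \<phi> p"
      "\<And>V. openin (mspace N) V \<Longrightarrow> f p \<in> V \<Longrightarrow> \<forall>\<^sub>F t in nhds 0. c t \<in> \<phi> ` (U \<inter> f -` V)"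
    and V: "(V, \<psi>) \<in> atlas N" "f p \<in> V"
    and d: "((\<lambda>t. \<psi> (f (inv_into U \<phi> (c t)))) has_vector_derivative d) (at 0)"
  shows "pullback N f \<gamma> (U, \<phi>) (\<phi> p) v = \<gamma> (V, \<psi>) (\<psi> (f p)) d"
proof -
  obtain V' \<psi>' where some: "(SOME c. c \<in> atlas N \<and> f p \<in> fst c) = (V', \<psi>')"
    by (metis surj_pair)
  have "(V', \<psi>') \<in> atlas N \<and> f p \<in> fst (V', \<psi>')"
    unfolding some[symmetric] by (rule someI[of _ "(V, \<psi>)"]) (use V in simp)
  then have V': "(V', \<psi>') \<in> atlas N" "f p \<in> V'" by simp_all
  let ?q = "\<lambda>t. f (inv_into U \<phi> (c t))"
  let ?d' = "frechet_derivative (\<psi>' \<circ> f \<circ> inv_into U \<phi>) (at (\<phi> p) within \<phi> ` (U \<inter> f -` V')) v"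
  let ?d'' = "frechet_derivative (\<psi>' \<circ> inv_into V \<psi>) (at (\<psi> (f p)) within \<psi> ` (V \<inter> V')) d"
  have in': "\<forall>\<^sub>F t in nhds 0. c t \<in> \<phi> ` (U \<inter> f -` V')"
    by (rule c(3)[OF smooth_atlasD(1)[OF N(1) V'(1)] V'(2)])
  have inV: "\<forall>\<^sub>F t in nhds 0. c t \<in> \<phi> ` (U \<inter> f -` V)"
    by (rule c(3)[OF smooth_atlasD(1)[OF N(1) V(1)] V(2)])
  have q: "\<forall>\<^sub>F t in nhds 0. ?q t \<in> V \<inter> V'"
  proof -
    have *: "f (inv_into U \<phi> y) \<in> A" if "y \<in> \<phi> ` (U \<inter> f -` A)" for y A
      using that inv_into_f_f[OF P(1)] by auto
    show ?thesis
      using in' inV by eventually_elim (intro IntI *)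
  qed
  have p: "inv_into U \<phi> (\<phi> p) = p" by (rule inv_into_f_f[OF P(1,2)])
  have "((\<lambda>t. \<psi>' (?q t)) has_vector_derivative ?d') (at 0)"
    using smooth_on_has_vector_derivative_curve[OF P(3)[OF V'(1)] c(1) in'] by (simp add: c(2))
  moreover have "((\<lambda>t. (\<psi>' \<circ> inv_into V \<psi>) (\<psi> (?q t))) has_vector_derivative ?d'') (at 0)"
  proof -
    have "\<forall>\<^sub>F t in nhds 0. \<psi> (?q t) \<in> \<psi> ` (V \<inter> V')"
      using q by eventually_elim (rule imageI)
    from smooth_on_has_vector_derivative_curve[OF smooth_atlasD(5)[OF N(1) V(1) V'(1)] d this]
    show ?thesis by (simp add: c(2) p)
  qed
  moreover have "\<forall>\<^sub>F t in nhds 0. \<psi>' (?q t) = (\<psi>' \<circ> inv_into V \<psi>) (\<psi> (?q t))"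
    using q by eventually_elim (simp add: inv_into_f_f[OF smooth_atlasD(4)[OF N(1) V(1)]])
  ultimately have "?d' = ?d''" by (rule has_vector_derivative_unique_eventually)
  moreover have "\<gamma> (V, \<psi>) (\<psi> (f p)) d = \<gamma> (V', \<psi>') (\<psi>' (f p)) ?d''"
  proof -
    note bspec[OF N(2)[unfolded one_form_def] V(1), unfolded case_prod_conv]
    then have "\<forall>(V', \<psi>')\<in>atlas N. \<forall>q\<in>V \<inter> V'. \<forall>v. \<gamma> (V, \<psi>) (\<psi> q) v =
        \<gamma> (V', \<psi>') (\<psi>' q) (frechet_derivative (\<psi>' \<circ> inv_into V \<psi>) (at (\<psi> q) within \<psi> ` (V \<inter> V')) v)"
      by (elim conjE)
    from bspec[OF this V'(1), unfolded case_prod_conv] show ?thesis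
      using V(2) V'(2) by blast
  qed
  ultimately show ?thesis
    by (simp add: pullback_def p some)
qed

section \<open>Invariance of the boundary and its atlas\<close>

lemma normal_dir_Basis: "(normal_dir :: 'm::euclidean_space) \<in> Basis"
  unfolding normal_dir_def by (rule SOME_Basis)

lemma bdry_hyperplane_subset_half_space: "bdry_hyperplane \<subseteq> half_space"
  by (auto simp: bdry_hyperplane_def half_space_def)

lemma subspace_bdry_hyperplane: "subspace bdry_hyperplane"
  by (simp add: bdry_hyperplane_def subspace_def inner_add_left)

text \<open>
  Boundary points do not depend on the chart: at an interior point of a chart, the height of another
  chart over its boundary hyperplane would have a minimum, contradicting that transition maps have
  invertible derivatives.
\<close>

lemma chart_maps_bdry_points:
  fixes M :: "('p, 'm::euclidean_space) mfld"
  assumes M: "smooth_atlas half_space M" and U: "(U, \<phi>) \<in> atlas M" and p: "p \<in> bdry_points M" "p \<in> U"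
  shows "\<phi> p \<in> bdry_hyperplane"
proof (rule ccontr)
  assume int: "\<phi> p \<notin> bdry_hyperplane"
  let ?e = "normal_dir :: 'm"
  obtain V \<psi> where V: "(V, \<psi>) \<in> atlas M" "p \<in> V" "\<psi> p \<in> bdry_hyperplane"
    using p(1) by (auto simp: bdry_points_def)
  note U' = smooth_atlasD[OF M U] and V' = smooth_atlasD[OF M V(1)]
  \<comment> \<open>Where the height is positive, the chart image is open in the whole model space,
    so derivatives within it become ordinary ones.\<close>
  define Q where "Q = \<phi> ` (U \<inter> V) \<inter> {x. 0 < x \<bullet> ?e}"
  have "openin (top_of_set half_space) (\<phi> ` (U \<inter> V))"
    by (rule chart_image_open[OF M U V'(1)])
  then obtain T where T: "open T" "\<phi> ` (U \<inter> V) = half_space \<inter> T"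
    by (auto simp: openin_open)
  have "Q = {x. 0 < x \<bullet> ?e} \<inter> T"
    unfolding Q_def T(2) by (auto simp: half_space_def)
  moreover have "open {x. 0 < x \<bullet> ?e}"
    by (simp add: open_halfspace_component_gt[of 0 ?e, simplified] normal_dir_Basis)
  ultimately have "open Q" using T(1) by blast
  have "\<phi> p \<in> half_space" using p(2) openin_subset[OF U'(2)] by auto
  then have pQ: "\<phi> p \<in> Q" using int p(2) V(2) by (auto simp: Q_def half_space_def bdry_hyperplane_def)
  define \<tau> where "\<tau> = \<psi> \<circ> inv_into U \<phi>"
  define D where "D = frechet_derivative \<tau> (at (\<phi> p) within \<phi> ` (U \<inter> V))"
  have "\<tau> differentiable (at (\<phi> p) within \<phi> ` (U \<inter> V))"
    unfolding \<tau>_def by (rule smooth_on_differentiable_within[OF U'(5)[OF V(1)]]) (use p V in auto)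
  then have "(\<tau> has_derivative D) (at (\<phi> p) within \<phi> ` (U \<inter> V))"
    unfolding D_def by (simp add: frechet_derivative_works)
  then have "(\<tau> has_derivative D) (at (\<phi> p) within Q)"
    by (rule has_derivative_subset) (auto simp: Q_def)
  then have D: "(\<tau> has_derivative D) (at (\<phi> p))"
    using at_within_open[OF pQ \<open>open Q\<close>] by simp
  define \<kappa> where "\<kappa> = \<phi> \<circ> inv_into V \<psi>"
  define D' where "D' = frechet_derivative \<kappa> (at (\<psi> p) within \<psi> ` (V \<inter> U))"
  have \<tau>p: "\<tau> (\<phi> q) = \<psi> q" if "q \<in> U" for q using that by (simp add: \<tau>_def inv_into_f_f[OF U'(4)])
  \<comment> \<open>The image under \<open>\<tau>\<close> of the line through
    \<open>\<phi> p\<close> stays in the other chart even though \<open>\<psi> p\<close> lies on the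
    hyperplane. Differentiating \<open>\<kappa> \<circ> \<tau> = id\<close> along it gives a left
    inverse of \<open>D\<close>, hence surjectivity in finite dimension.\<close>
  have inv: "D' (D v) = v" for v
  proof -
    have ev: "\<forall>\<^sub>F t in nhds 0. \<phi> p + t *\<^sub>R v \<in> Q"
      by (rule eventually_nhds_continuous_openin[of UNIV]) (use pQ \<open>open Q\<close> in auto)
    have "((\<lambda>t. \<tau> (\<phi> p + t *\<^sub>R v)) has_vector_derivative D v) (at 0)"
      using has_vector_derivative_frechet_line[of \<tau> "\<phi> p" v] D frechet_derivative_at[OF D]
      by (auto simp: differentiable_def)
    moreover have "\<forall>\<^sub>F t in nhds 0. \<tau> (\<phi> p + t *\<^sub>R v) \<in> \<psi> ` (V \<inter> U)"
      using ev by eventually_elim (auto simp: Q_def \<tau>p)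
    ultimately have "((\<lambda>t. \<kappa> (\<tau> (\<phi> p + t *\<^sub>R v))) has_vector_derivative D' (D v)) (at 0)"
      using smooth_on_has_vector_derivative_curve[OF V'(5)[OF U], of "\<lambda>t. \<tau> (\<phi> p + t *\<^sub>R v)"] p(2)
      by (simp add: D'_def \<kappa>_def \<tau>p)
    moreover have "\<forall>\<^sub>F t in nhds 0. \<kappa> (\<tau> (\<phi> p + t *\<^sub>R v)) = \<phi> p + t *\<^sub>R v"
      using ev by eventually_elim (auto simp: Q_def \<tau>p \<kappa>_def inv_into_f_f[OF V'(4)])
    ultimately show ?thesis
      by (rule has_vector_derivative_unique_eventually[OF _ has_vector_derivative_line])
  qed
  have "((\<lambda>x. \<tau> x \<bullet> ?e) has_derivative (\<lambda>v. D v \<bullet> ?e)) (at (\<phi> p))"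
    by (rule has_derivative_inner_left[OF D])
  moreover have "\<tau> (\<phi> p) \<bullet> ?e \<le> \<tau> y \<bullet> ?e" if "y \<in> Q" for y
  proof -
    obtain q where q: "q \<in> U \<inter> V" "y = \<phi> q" using \<open>y \<in> Q\<close> by (auto simp: Q_def)
    then have "\<psi> q \<in> half_space" using openin_subset[OF V'(2)] by auto
    then show ?thesis using q V(3) p(2) by (simp add: \<tau>p half_space_def bdry_hyperplane_def)
  qed
  ultimately have "(\<lambda>v. D v \<bullet> ?e) = (\<lambda>v. 0)"
    using differential_zero_maxmin[OF pQ \<open>open Q\<close>] by blast
  then have D0: "D v \<bullet> ?e = 0" for v by (rule fun_cong)
  have "inj D" by (rule inj_on_inverseI[of _ D']) (rule inv)
  then have "surj D"
    by (rule linear_injective_imp_surjective[OF has_derivative_linear[OF D] _ refl])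
  then obtain v where "D v = ?e" by (metis surjD)
  then have "?e \<bullet> ?e = 0" using D0[of v] by simp
  then show False using nonzero_Basis[OF normal_dir_Basis[where 'm = 'm]] by simp
qed

lemma bdry_points_subset: "smooth_atlas K M \<Longrightarrow> bdry_points M \<subseteq> points M"
  by (force simp: smooth_atlas_def bdry_points_def)

text \<open>By chart independence of boundary points, a chart maps the boundary part of its domain
  onto the intersection of its image with the hyperplane, which is relatively open there.\<close>

lemma smooth_atlas_bdry:
  fixes M :: "('p, 'm::euclidean_space) mfld"
  assumes M: "smooth_atlas half_space M"
  shows "smooth_atlas bdry_hyperplane (bdry M)"
  unfolding bdry_def
proof (rule smooth_atlas_submfld[OF M bdry_points_subset[OF M]])
  fix U \<phi> assume U: "(U, \<phi>) \<in> atlas M"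
  have "\<phi> ` (U \<inter> bdry_points M) = \<phi> ` U \<inter> bdry_hyperplane"
    using chart_maps_bdry_points[OF M U] U by (auto simp: bdry_points_def)
  then show "openin (top_of_set bdry_hyperplane) (\<phi> ` (U \<inter> bdry_points M))"
    using openin_subtopology_Int2 smooth_atlasD(2)[OF M U] bdry_hyperplane_subset_half_space
    by (metis inf_commute openin_Int_open openin_open inf.assoc inf.absorb_iff1)
qed

lemma points_bdry: "smooth_atlas K M \<Longrightarrow> points (bdry M) = bdry_points M"
  by (auto simp: bdry_def submfld_def dest: bdry_points_subset)

section \<open>Charts adapted to the circle bundle\<close>

lemma has_vector_derivative_circle_curve:
  "((\<lambda>t. cis (s * t) * z) has_vector_derivative s *\<^sub>R (\<i> * z)) (at 0)"
proof -
  have "((\<lambda>t. exp (t *\<^sub>R (s *\<^sub>R \<i>))) has_vector_derivative exp (0 *\<^sub>R (s *\<^sub>R \<i>)) * (s *\<^sub>R \<i>)) (at 0)"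
    by (rule exp_scaleR_has_vector_derivative_right)
  moreover have "exp (t *\<^sub>R (s *\<^sub>R \<i>)) = cis (s * t)" for t
    by (simp add: cis_conv_exp scaleR_conv_of_real mult_ac)
  ultimately have "((\<lambda>t. cis (s * t)) has_vector_derivative s *\<^sub>R \<i>) (at 0)"
    by simp
  from bounded_linear.has_vector_derivative[OF bounded_linear_mult_left[of z] this]
  show ?thesis by simp
qed

text \<open>Differentiating \<open>\<theta> t \<bullet> \<theta> t = 1\<close> shows that
  \<open>d * cnj (\<theta> 0)\<close> is purely imaginary; multiplying by \<open>\<theta> 0\<close>
  recovers \<open>d\<close>.\<close>

lemma circle_tangent:
  assumes \<theta>: "(\<theta> has_vector_derivative d) (at 0)" and circ: "\<forall>\<^sub>F t in nhds 0. \<theta> t \<in> circle"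
  shows "\<exists>s. d = s *\<^sub>R (\<i> * \<theta> 0)"
proof -
  have "((\<lambda>t. \<theta> t \<bullet> \<theta> t) has_derivative (\<lambda>h. \<theta> 0 \<bullet> (h *\<^sub>R d) + (h *\<^sub>R d) \<bullet> \<theta> 0)) (at 0)"
    using \<theta> unfolding has_vector_derivative_def by (intro has_derivative_inner)
  then have "((\<lambda>t. \<theta> t \<bullet> \<theta> t) has_vector_derivative 2 * (d \<bullet> \<theta> 0)) (at 0)"
    by (simp add: has_vector_derivative_def inner_commute mult_ac)
  moreover have "\<forall>\<^sub>F t in nhds 0. \<theta> t \<bullet> \<theta> t = 1"
    using circ by eventually_elim (simp add: dot_square_norm)
  ultimately have "2 * (d \<bullet> \<theta> 0) = 0"
    by (rule has_vector_derivative_unique_eventually[where g = "\<lambda>_. 1", OF _ has_vector_derivative_const])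
  then have re: "Re (d * cnj (\<theta> 0)) = 0" by (simp add: inner_complex_def)
  have "\<theta> 0 \<in> circle" using circ eventually_nhds_x_imp_x by blast
  then have 1: "cnj (\<theta> 0) * \<theta> 0 = 1"
    using complex_norm_square[of "\<theta> 0"] by (simp add: mult.commute)
  have "d * cnj (\<theta> 0) = Im (d * cnj (\<theta> 0)) *\<^sub>R \<i>"
    by (rule complex_eqI) (use re in simp_all)
  then have "d * (cnj (\<theta> 0) * \<theta> 0) = Im (d * cnj (\<theta> 0)) *\<^sub>R (\<i> * \<theta> 0)"
    by (metis mult.assoc mult_scaleR_left)
  then show ?thesis unfolding 1 by auto
qed

text \<open>\<open>F\<close> and \<open>K\<close> stand for a local trivialization and its inverse
  in coordinates. Neither \<open>S\<close> nor \<open>T\<close> is open, so the derivatives are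
  shown to be mutually inverse only between the hyperplane and the vectors
  \<open>(w, s *\<^sub>R (\<i> * z))\<close> tangent to the product.\<close>

lemma circle_product_diffeo_derivatives:
  fixes S :: "'m::euclidean_space set" and T :: "('r::euclidean_space \<times> complex) set"
  assumes F: "smooth_on S F" "\<forall>y\<in>S. F y \<in> T \<and> K (F y) = y"
    and K: "smooth_on T K" "\<forall>u\<in>T. K u \<in> S \<and> F (K u) = u"
    and sub: "S \<subseteq> bdry_hyperplane" "T \<subseteq> UNIV \<times> circle"
    and x: "x \<in> S" "F x = (y, z)"
    and S: "\<forall>h\<in>bdry_hyperplane. \<forall>\<^sub>F t in nhds 0. x + t *\<^sub>R h \<in> S"
    and T: "\<And>w s. \<forall>\<^sub>F t in nhds 0. (y + t *\<^sub>R w, cis (s * t) * z) \<in> T"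
  defines "D \<equiv> frechet_derivative F (at x within S)"
    and "D' \<equiv> frechet_derivative K (at (y, z) within T)"
  shows "linear D'"
    and "\<And>h. h \<in> bdry_hyperplane \<Longrightarrow> ((\<lambda>t. F (x + t *\<^sub>R h)) has_vector_derivative D h) (at 0)"
    and "\<And>h. h \<in> bdry_hyperplane \<Longrightarrow> \<exists>s. snd (D h) = s *\<^sub>R (\<i> * z)"
    and "\<And>h. h \<in> bdry_hyperplane \<Longrightarrow> D' (D h) = h"
    and "\<And>w s. D' (w, s *\<^sub>R (\<i> * z)) \<in> bdry_hyperplane"
    and "\<And>w s. D (D' (w, s *\<^sub>R (\<i> * z))) = (w, s *\<^sub>R (\<i> * z))"
proof -
  have "(y, z) \<in> T" and Kyz: "K (y, z) = x" using bspec[OF F(2) x(1)] x(2) by auto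
  then show "linear D'"
    unfolding D'_def
    using smooth_on_differentiable_within[OF K(1)] frechet_derivative_works has_derivative_linear by blast
  show der: "((\<lambda>t. F (x + t *\<^sub>R h)) has_vector_derivative D h) (at 0)" if "h \<in> bdry_hyperplane" for h
    using smooth_on_has_vector_derivative_curve[OF F(1) has_vector_derivative_line bspec[OF S that]]
    by (simp add: D_def)
  show "\<exists>s. snd (D h) = s *\<^sub>R (\<i> * z)" if "h \<in> bdry_hyperplane" for h
  proof -
    have "((\<lambda>t. snd (F (x + t *\<^sub>R h))) has_vector_derivative snd (D h)) (at 0)"
      by (rule bounded_linear.has_vector_derivative[OF bounded_linear_snd der[OF that]])
    moreover have "\<forall>\<^sub>F t in nhds 0. snd (F (x + t *\<^sub>R h)) \<in> circle"
      using bspec[OF S that] by eventually_elim (use F(2) sub(2) in force)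
    ultimately show ?thesis using circle_tangent x(2) by fastforce
  qed
  show "D' (D h) = h" if "h \<in> bdry_hyperplane" for h
  proof -
    have "\<forall>\<^sub>F t in nhds 0. F (x + t *\<^sub>R h) \<in> T"
      using bspec[OF S that] by eventually_elim (use F(2) in blast)
    from smooth_on_has_vector_derivative_curve[OF K(1) der[OF that] this]
    have "((\<lambda>t. K (F (x + t *\<^sub>R h))) has_vector_derivative D' (D h)) (at 0)"
      by (simp add: D'_def x(2))
    moreover have "\<forall>\<^sub>F t in nhds 0. K (F (x + t *\<^sub>R h)) = x + t *\<^sub>R h"
      using bspec[OF S that] by eventually_elim (use F(2) in blast)
    ultimately show ?thesis
      by (rule has_vector_derivative_unique_eventually[OF _ has_vector_derivative_line])
  qed
  fix w s
  \<comment> \<open>The second component has to rotate, since a straight line would leave the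
    circle.\<close>
  let ?k = "\<lambda>t. (y + t *\<^sub>R w, cis (s * t) * z)"
  have k: "(?k has_vector_derivative (w, s *\<^sub>R (\<i> * z))) (at 0)"
    by (intro has_vector_derivative_Pair has_vector_derivative_line has_vector_derivative_circle_curve)
  have Kk: "((\<lambda>t. K (?k t)) has_vector_derivative D' (w, s *\<^sub>R (\<i> * z))) (at 0)"
    using smooth_on_has_vector_derivative_curve[OF K(1) k T] by (simp add: D'_def)
  have KS: "\<forall>\<^sub>F t in nhds 0. K (?k t) \<in> S"
    using T[of w s] by eventually_elim (use K(2) in blast)
  show "D' (w, s *\<^sub>R (\<i> * z)) \<in> bdry_hyperplane"
  proof -
    have "((\<lambda>t. K (?k t) \<bullet> normal_dir) has_vector_derivative D' (w, s *\<^sub>R (\<i> * z)) \<bullet> normal_dir) (at 0)"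
      by (rule bounded_linear.has_vector_derivative[OF bounded_linear_inner_left Kk])
    moreover have "\<forall>\<^sub>F t in nhds 0. K (?k t) \<bullet> normal_dir = 0"
      using KS by eventually_elim (use sub(1) in \<open>auto simp: bdry_hyperplane_def\<close>)
    ultimately have "D' (w, s *\<^sub>R (\<i> * z)) \<bullet> normal_dir = 0"
      by (rule has_vector_derivative_unique_eventually[where g = "\<lambda>_. 0", OF _ has_vector_derivative_const])
    then show ?thesis by (simp add: bdry_hyperplane_def)
  qed
  show "D (D' (w, s *\<^sub>R (\<i> * z))) = (w, s *\<^sub>R (\<i> * z))"
  proof -
    have "((\<lambda>t. F (K (?k t))) has_vector_derivative D (D' (w, s *\<^sub>R (\<i> * z)))) (at 0)"
      using smooth_on_has_vector_derivative_curve[OF F(1) Kk KS] by (simp add: D_def Kyz)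
    moreover have "\<forall>\<^sub>F t in nhds 0. F (K (?k t)) = ?k t"
      using T[of w s] by eventually_elim (use K(2) in blast)
    ultimately show ?thesis
      by (rule has_vector_derivative_unique_eventually[OF _ k])
  qed
qed

section \<open>Local description of the quotient map\<close>

lemma atlas_bdry: "(U, \<phi>) \<in> atlas M \<Longrightarrow> (U \<inter> bdry_points M, \<phi>) \<in> atlas (bdry M)"
  by (force simp: bdry_def submfld_def)

lemma smooth_mapD:
  assumes "smooth_map M N f"
  shows "continuous_map (mspace M) (mspace N) f"
    and "(U, \<phi>) \<in> atlas M \<Longrightarrow> (V, \<psi>) \<in> atlas N \<Longrightarrow>
      smooth_on (\<phi> ` (U \<inter> f -` V)) (\<psi> \<circ> f \<circ> inv_into U \<phi>)"
proof -
  show "continuous_map (mspace M) (mspace N) f" using assms by (simp add: smooth_map_def)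
  have *: "\<forall>(U, \<phi>)\<in>atlas M. \<forall>(V, \<psi>)\<in>atlas N. smooth_on (\<phi> ` (U \<inter> f -` V)) (\<psi> \<circ> f \<circ> inv_into U \<phi>)"
    using assms unfolding smooth_map_def by (elim conjE)
  assume U: "(U, \<phi>) \<in> atlas M" and V: "(V, \<psi>) \<in> atlas N"
  show "smooth_on (\<phi> ` (U \<inter> f -` V)) (\<psi> \<circ> f \<circ> inv_into U \<phi>)"
    using bspec[OF bspec[OF * U, unfolded case_prod_conv] V] by simp
qed

lemma eventually_line_in_bdry_chart:
  assumes "openin (top_of_set bdry_hyperplane) A" "x \<in> A" "h \<in> bdry_hyperplane"
  shows "\<forall>\<^sub>F t in nhds 0. x + t *\<^sub>R h \<in> A"
proof (rule eventually_nhds_continuous_openin[OF assms(1)])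
  have "x \<in> bdry_hyperplane" using assms(1,2) openin_subset by fastforce
  then have "x + t *\<^sub>R h \<in> bdry_hyperplane" for t
    using assms(3) by (intro subspace_add subspace_scale subspace_bdry_hyperplane)
  then show "\<forall>\<^sub>F t in nhds 0. x + t *\<^sub>R h \<in> bdry_hyperplane" by simp
qed (use assms(2) in auto)

text \<open>\<open>G\<close> extends the coordinate form of the projection beyond the hyperplane;
  smoothness on a non-open set means that such an extension exists locally. The lift
  \<open>l w\<close> and the vertical vector \<open>X\<close> are the images of
  \<open>(w, 0)\<close> and \<open>(0, \<i> * z)\<close> under the derivative of the inverse
  trivialization.\<close>

lemma reduction_chart:
  fixes M :: "('p, 'm::euclidean_space) mfld" and B :: "('q, 'r::euclidean_space) mfld"
  assumes M: "smooth_atlas half_space M" and B: "smooth_atlas UNIV B"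
    and princ: "principal_circle_bundle (bdry M) act B \<pi>"
    and U: "(U, \<phi>) \<in> atlas M" "p \<in> U" "p \<in> bdry_points M"
    and V: "(V, \<xi>) \<in> atlas B" "\<pi> p \<in> V"
  obtains G W and l :: "'r \<Rightarrow> 'm" and X
  where "open W" "\<phi> p \<in> W" "\<forall>k. C_k_on k W G"
    "\<And>q. q \<in> U \<Longrightarrow> q \<in> bdry_points M \<Longrightarrow> \<pi> q \<in> V \<Longrightarrow> \<phi> q \<in> W \<Longrightarrow> G (\<phi> q) = \<xi> (\<pi> q)"
    "linear l" "\<And>w. l w \<in> bdry_hyperplane" "\<And>w. frechet_derivative G (at (\<phi> p)) (l w) = w"
    "X \<in> bdry_hyperplane" "frechet_derivative G (at (\<phi> p)) X = 0" "X \<noteq> 0"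
    "\<And>h. h \<in> bdry_hyperplane \<Longrightarrow> \<exists>c. h = l (frechet_derivative G (at (\<phi> p)) h) + c *\<^sub>R X"
proof -
  let ?P = "bdry M" and ?U = "U \<inter> bdry_points M"
  have P: "smooth_atlas bdry_hyperplane ?P" by (rule smooth_atlas_bdry[OF M])
  have ptsP: "points ?P = bdry_points M" by (rule points_bdry[OF M])
  have U': "(?U, \<phi>) \<in> atlas ?P" by (rule atlas_bdry[OF U(1)])
  have pU: "p \<in> ?U" using U by simp
  note injU = smooth_atlasD(4)[OF P U'] and injV = smooth_atlasD(4)[OF B V(1)]
  have Vpts: "V \<subseteq> points B" by (rule openin_subset[OF smooth_atlasD(1)[OF B V(1)]])
  have \<pi>: "smooth_map ?P B \<pi>" using princ by (simp add: principal_circle_bundle_def)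
  then have \<pi>_cont: "continuous_map (mspace ?P) (mspace B) \<pi>" by (simp add: smooth_map_def)
  have "\<pi> p \<in> points B" using Vpts V(2) by blast
  moreover have "\<forall>b\<in>points B. \<exists>W \<Phi>. openin (mspace B) W \<and> b \<in> W \<and>
        diffeo (submfld ?P (points ?P \<inter> \<pi> -` W)) (prod_mfld (submfld B W) circle_mfld) \<Phi> \<and>
        (\<forall>p\<in>points ?P \<inter> \<pi> -` W. fst (\<Phi> p) = \<pi> p \<and>
           (\<forall>z\<in>circle. \<Phi> (act z p) = (\<pi> p, z * snd (\<Phi> p))))"
    using princ unfolding principal_circle_bundle_def by (elim conjE)
  ultimately obtain N \<Phi> where N: "openin (mspace B) N" "\<pi> p \<in> N"
    and dif: "diffeo (submfld ?P (points ?P \<inter> \<pi> -` N)) (prod_mfld (submfld B N) circle_mfld) \<Phi>"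
    and triv: "\<forall>q\<in>points ?P \<inter> \<pi> -` N. fst (\<Phi> q) = \<pi> q \<and>
      (\<forall>z\<in>circle. \<Phi> (act z q) = (\<pi> q, z * snd (\<Phi> q)))"
    by (metis (no_types, lifting))
  have fst\<Phi>: "fst (\<Phi> q) = \<pi> q" if "q \<in> points ?P \<inter> \<pi> -` N" for q
    using bspec[OF triv that] by (rule conjunct1)
  define A where "A = points ?P \<inter> \<pi> -` N"
  let ?Q1 = "submfld ?P A" and ?Q2 = "prod_mfld (submfld B N) circle_mfld"
  obtain \<Psi> where \<Phi>: "smooth_map ?Q1 ?Q2 \<Phi>" and \<Psi>: "smooth_map ?Q2 ?Q1 \<Psi>"
    and inverse: "\<forall>q\<in>points ?Q1. \<Psi> (\<Phi> q) = q" "\<forall>u\<in>points ?Q2. \<Phi> (\<Psi> u) = u"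
    using dif unfolding diffeo_def A_def[symmetric] by (elim exE conjE) (rule that)
  note \<Psi>\<Phi> = bspec[OF inverse(1)] and \<Phi>\<Psi> = bspec[OF inverse(2)]
  have pts1: "points ?Q1 = A" by (auto simp: submfld_def A_def)
  have pts2: "points ?Q2 = (points B \<inter> N) \<times> circle"
    by (simp add: prod_mfld_def submfld_def circle_mfld_def)
  have \<Phi>_cont: "continuous_map (mspace ?Q1) (mspace ?Q2) \<Phi>"
    and \<Psi>_cont: "continuous_map (mspace ?Q2) (mspace ?Q1) \<Psi>"
    using smooth_mapD(1)[OF \<Phi>] smooth_mapD(1)[OF \<Psi>] .
  have A_open: "openin (mspace ?P) A"
    using openin_continuous_map_preimage[OF \<pi>_cont N(1)] by (simp add: A_def vimage_def Int_def)
  have Q1: "smooth_atlas bdry_hyperplane ?Q1"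
    by (rule smooth_atlas_submfld[OF P]) (auto simp: A_def intro: chart_image_open[OF P _ A_open, unfolded A_def])
  define U0 where "U0 = ?U \<inter> A"
  define V0 where "V0 = (V \<inter> N) \<times> circle"
  define ch where "ch = map_prod \<xi> (id :: complex \<Rightarrow> complex)"
  have U0: "(U0, \<phi>) \<in> atlas ?Q1" using U' by (force simp: submfld_def U0_def)
  have "(V \<inter> N, \<xi>) \<in> atlas (submfld B N)" using V(1) by (force simp: submfld_def)
  then have V0: "(V0, ch) \<in> atlas ?Q2"
    by (auto simp: prod_mfld_def circle_mfld_def V0_def ch_def)
  have injU0: "inj_on \<phi> U0" using injU by (rule inj_on_subset) (auto simp: U0_def)
  have injV0: "inj_on ch V0"
    using injV by (auto simp: inj_on_def V0_def ch_def)
  have V0_open: "openin (mspace ?Q2) V0"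
  proof -
    have "openin (subtopology (mspace B) N) (V \<inter> N)"
      using smooth_atlasD(1)[OF B V(1)] by (rule openin_subtopology_Int)
    then show ?thesis
      by (simp add: prod_mfld_def submfld_def circle_mfld_def V0_def openin_prod_Times_iff)
  qed
  define S where "S = \<phi> ` (U0 \<inter> \<Phi> -` V0)"
  define T where "T = ch ` (V0 \<inter> \<Psi> -` U0)"
  define F where "F = ch \<circ> \<Phi> \<circ> inv_into U0 \<phi>"
  define K where "K = \<phi> \<circ> \<Psi> \<circ> inv_into V0 ch"
  have F_smooth: "smooth_on S F" and K_smooth: "smooth_on T K"
    unfolding S_def F_def T_def K_def
    using smooth_mapD(2)[OF \<Phi> U0 V0] smooth_mapD(2)[OF \<Psi> V0 U0] .
  have S_open: "openin (top_of_set bdry_hyperplane) S"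
    unfolding S_def by (rule chart_preimage_open[OF Q1 U0 \<Phi>_cont V0_open])
  have F_eq: "F (\<phi> q) = ch (\<Phi> q)" if "q \<in> U0" for q
    by (simp add: F_def inv_into_f_f[OF injU0 that])
  have K_eq: "K (ch u) = \<phi> (\<Psi> u)" if "u \<in> V0" for u
    by (simp add: K_def inv_into_f_f[OF injV0 that])
  have FS: "\<forall>y\<in>S. F y \<in> T \<and> K (F y) = y"
  proof
    fix y assume y: "y \<in> S"
    obtain q where q: "q \<in> U0" "\<Phi> q \<in> V0" "y = \<phi> q" using y by (auto simp: S_def)
    have "\<Psi> (\<Phi> q) = q" using q(1) by (intro \<Psi>\<Phi>) (simp add: pts1 U0_def)
    then show "F y \<in> T \<and> K (F y) = y" using q by (auto simp: F_eq K_eq T_def)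
  qed
  have KT: "\<forall>u\<in>T. K u \<in> S \<and> F (K u) = u"
  proof
    fix u assume u: "u \<in> T"
    obtain b where b: "b \<in> V0" "\<Psi> b \<in> U0" "u = ch b" using u by (auto simp: T_def)
    have "\<Phi> (\<Psi> b) = b" using b(1) Vpts by (intro \<Phi>\<Psi>) (auto simp: pts2 V0_def)
    then show "K u \<in> S \<and> F (K u) = u" using b by (auto simp: F_eq K_eq S_def)
  qed
  have pU0: "p \<in> U0" using pU N(2) by (simp add: U0_def A_def ptsP)
  define z where "z = snd (\<Phi> p)"
  have "\<Phi> p \<in> points ?Q2"
    using \<Phi>_cont pU0 by (auto simp: continuous_map_def pts1 U0_def)
  then have z: "z \<in> circle" by (auto simp: z_def pts2)
  have \<Phi>p: "\<Phi> p = (\<pi> p, z)"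
    using fst\<Phi>[of p] pU0 by (simp add: z_def prod_eq_iff U0_def A_def)
  then have \<Phi>pV0: "\<Phi> p \<in> V0" using V(2) N(2) z by (simp add: V0_def)
  define y where "y = \<xi> (\<pi> p)"
  have x: "\<phi> p \<in> S" "F (\<phi> p) = (y, z)"
    using pU0 \<Phi>pV0 by (auto simp: S_def F_eq \<Phi>p ch_def y_def)
  \<comment> \<open>The preimage of \<open>U0\<close> under \<open>\<Psi>\<close> is open and
    contains \<open>(\<pi> p, z)\<close>, hence also a product neighbourhood
    \<open>E \<times> C\<close>; the two components of the curve can then be treated
    separately.\<close>
  have Tev: "\<forall>\<^sub>F t in nhds 0. (y + t *\<^sub>R w, cis (s * t) * z) \<in> T" for w :: 'r and s
  proof -
    define Z where "Z = {u \<in> points ?Q2. \<Psi> u \<in> U0}"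
    have "openin (mspace ?Q2) Z"
      unfolding Z_def by (rule openin_continuous_map_preimage[OF \<Psi>_cont smooth_atlasD(1)[OF Q1 U0]])
    moreover have "mspace ?Q2 = prod_topology (subtopology (mspace B) N) (top_of_set circle)"
      by (simp add: prod_mfld_def submfld_def circle_mfld_def)
    ultimately have Z_open: "openin (prod_topology (subtopology (mspace B) N) (top_of_set circle)) Z"
      by simp
    have "\<Psi> (\<pi> p, z) \<in> U0"
      using \<Psi>\<Phi>[of p] pU0 by (simp add: \<Phi>p pts1 U0_def)
    then have "(\<pi> p, z) \<in> Z"
      using \<open>\<Phi> p \<in> points ?Q2\<close> by (simp add: \<Phi>p Z_def)
    from Z_open[unfolded openin_prod_topology_alt, rule_format, OF this]
    obtain E C where EC: "openin (subtopology (mspace B) N) E" "openin (top_of_set circle) C"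
        "\<pi> p \<in> E" "z \<in> C" "E \<times> C \<subseteq> Z"
      by (elim exE conjE) (rule that)
    have E: "openin (mspace B) E" "E \<subseteq> N"
      using EC(1) N(1) by (auto simp: openin_open_subtopology)
    have "\<forall>\<^sub>F t in nhds 0. y + t *\<^sub>R w \<in> \<xi> ` (V \<inter> E)"
      by (rule eventually_nhds_continuous_openin[OF chart_image_open[OF B V(1) E(1)]])
        (use V(2) EC(3) in \<open>auto simp: y_def\<close>)
    moreover have "\<forall>\<^sub>F t in nhds 0. cis (s * t) * z \<in> C"
    proof (rule eventually_nhds_continuous_openin[OF EC(2)])
      show "isCont (\<lambda>t. cis (s * t) * z) 0"
        using has_vector_derivative_continuous[OF has_vector_derivative_circle_curve] .
      show "\<forall>\<^sub>F t in nhds 0. cis (s * t) * z \<in> circle" using z by (simp add: norm_mult)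
    qed (use EC(4) in simp)
    ultimately show ?thesis
    proof eventually_elim
      case (elim t)
      then obtain b where b: "b \<in> V" "b \<in> E" "y + t *\<^sub>R w = \<xi> b" by auto
      have "cis (s * t) * z \<in> circle" using z by (simp add: norm_mult)
      then have "(b, cis (s * t) * z) \<in> V0 \<inter> \<Psi> -` U0"
        using b E(2) elim(2) EC(5) by (auto simp: V0_def Z_def)
      then show ?case unfolding T_def b(3) ch_def by force
    qed
  qed
  have SH: "S \<subseteq> bdry_hyperplane" using openin_subset[OF S_open] by simp
  have TC: "T \<subseteq> UNIV \<times> circle" by (auto simp: T_def V0_def ch_def)
  have Sev: "\<forall>h\<in>bdry_hyperplane. \<forall>\<^sub>F t in nhds 0. \<phi> p + t *\<^sub>R h \<in> S"
    by (rule ballI) (rule eventually_line_in_bdry_chart[OF S_open x(1)])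
  note D = circle_product_diffeo_derivatives[OF F_smooth FS K_smooth KT SH TC x Sev Tev]
  define D1 where "D1 = frechet_derivative F (at (\<phi> p) within S)"
  define D2 where "D2 = frechet_derivative K (at (y, z) within T)"
  note D = D[folded D1_def D2_def]
  have G_smooth: "smooth_on (\<phi> ` (?U \<inter> \<pi> -` V)) (\<xi> \<circ> \<pi> \<circ> inv_into ?U \<phi>)"
    by (rule smooth_mapD(2)[OF \<pi> U' V(1)])
  have "\<phi> p \<in> \<phi> ` (?U \<inter> \<pi> -` V)" using pU V(2) by blast
  from bspec[OF G_smooth[unfolded smooth_on_def] this] obtain W G where W: "open W" "\<phi> p \<in> W" "\<forall>k. C_k_on k W G"
      and G: "\<forall>y\<in>\<phi> ` (?U \<inter> \<pi> -` V) \<inter> W. G y = (\<xi> \<circ> \<pi> \<circ> inv_into ?U \<phi>) y"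
    by (elim exE conjE) (rule that)
  have G_eq: "G (\<phi> q) = \<xi> (\<pi> q)" if "q \<in> U" "q \<in> bdry_points M" "\<pi> q \<in> V" "\<phi> q \<in> W" for q
    using bspec[OF G, of "\<phi> q"] that inv_into_f_f[OF injU, of q] by auto
  let ?D = "frechet_derivative G (at (\<phi> p))"
  have G_diff: "G differentiable (at (\<phi> p))"
    using C_k_on_all_has_derivative[OF W(3,2)] by (auto simp: differentiable_def)
  \<comment> \<open>Off the hyperplane \<open>?D\<close> depends on the extension; in hyperplane
    directions \<open>G\<close> agrees with the first component of \<open>F\<close> along the line,
    which fixes the value.\<close>
  have DG: "?D h = fst (D1 h)" if h: "h \<in> bdry_hyperplane" for h
  proof -
    have "\<forall>\<^sub>F t in nhds 0. \<phi> p + t *\<^sub>R h \<in> W"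
      by (rule eventually_nhds_continuous_openin[of UNIV]) (use W in auto)
    then have "\<forall>\<^sub>F t in nhds 0. G (\<phi> p + t *\<^sub>R h) = fst (F (\<phi> p + t *\<^sub>R h))"
      using bspec[OF Sev h]
    proof eventually_elim
      case (elim t)
      then obtain q where q: "q \<in> U0" "\<Phi> q \<in> V0" "\<phi> p + t *\<^sub>R h = \<phi> q" by (auto simp: S_def)
      then have "fst (\<Phi> q) = \<pi> q" by (intro fst\<Phi>) (auto simp: U0_def A_def)
      moreover have "\<pi> q \<in> V" using q(2) calculation by (auto simp: V0_def)
      ultimately show ?case
        using q elim(1) G_eq[of q] by (simp add: F_eq ch_def U0_def)
    qed
    then show ?thesis
      using has_vector_derivative_unique_eventually[OF has_vector_derivative_frechet_line[OF G_diff]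
          bounded_linear.has_vector_derivative[OF bounded_linear_fst D(2)[OF h]]] by blast
  qed
  define l where "l = (\<lambda>w. D2 (w, 0))"
  define X where "X = D2 (0, \<i> * z)"
  have lX: "D2 (w, s *\<^sub>R (\<i> * z)) = l w + s *\<^sub>R X" for w s
  proof -
    have "(w, s *\<^sub>R (\<i> * z)) = (w, 0) + s *\<^sub>R (0, \<i> * z)" by simp
    then show ?thesis
      using linear_add[OF D(1)] linear_cmul[OF D(1)] by (simp only: l_def X_def)
  qed
  show thesis
  proof (rule that[OF W G_eq])
    show "linear l"
      unfolding l_def using linear_compose[OF _ D(1), of "\<lambda>w. (w, 0)"]
      by (simp add: o_def linear_iff)
    show lH: "l w \<in> bdry_hyperplane" for w using D(5)[of w 0] by (simp add: l_def)
    show "?D (l w) = w" for w using DG[OF lH] D(6)[of w 0] by (simp add: l_def)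
    show XH: "X \<in> bdry_hyperplane" using D(5)[of 0 1] by (simp add: X_def)
    show "?D X = 0" using DG[OF XH] D(6)[of 0 1] by (simp add: X_def)
    \<comment> \<open>Otherwise \<open>D2\<close> would not separate \<open>(0, 0)\<close> from
      \<open>(0, \<i> * z)\<close>, although \<open>D1\<close> inverts it on such vectors.\<close>
    show "X \<noteq> 0"
    proof
      assume "X = 0"
      then have "D2 (0, 0 *\<^sub>R (\<i> * z)) = D2 (0, 1 *\<^sub>R (\<i> * z))" by (simp only: lX scaleR_zero_right)
      then have "(0, 0 *\<^sub>R (\<i> * z)) = (0 :: 'r, 1 *\<^sub>R (\<i> * z))" using D(6) by metis
      then have "z = 0" by simp
      then show False using z by simp
    qed
    fix h :: 'm assume h: "h \<in> bdry_hyperplane"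
    obtain s where "snd (D1 h) = s *\<^sub>R (\<i> * z)" using D(3)[OF h] by blast
    then have "D1 h = (?D h, s *\<^sub>R (\<i> * z))" by (simp add: prod_eq_iff DG[OF h])
    then have "h = l (?D h) + s *\<^sub>R X" using D(4)[OF h] lX by metis
    then show "\<exists>c. h = l (?D h) + c *\<^sub>R X" by blast
  qed
qed

section \<open>The reduced form\<close>

text \<open>Since \<open>normal_dir\<close> is itself a basis vector, no basis vector has a negative
  inner product with it. Positive steps along the basis thus stay in the half-space even from a
  boundary point, which is enough for uniqueness.\<close>

lemma half_space_has_derivative_unique:
  fixes f :: "'m::euclidean_space \<Rightarrow> 'b::real_normed_vector"
  assumes S: "openin (top_of_set half_space) S" "x \<in> S"
    and "(f has_derivative D) (at x within S)" "(f has_derivative D') (at x within S)"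
  shows "D = D'"
proof (rule frechet_derivative_unique_within[OF assms(3,4)])
  fix i :: 'm and e :: real assume i: "i \<in> Basis" "0 < e"
  obtain T where T: "open T" "S = half_space \<inter> T" using S(1) by (auto simp: openin_open)
  then obtain r where r: "0 < r" "ball x r \<subseteq> T" using S(2) open_contains_ball by blast
  define d where "d = min e r / 2"
  have d: "0 < d" "d < e" "d < r" using i(2) r(1) by (auto simp: d_def min_def)
  have "x + d *\<^sub>R i \<in> ball x r" using d i(1) by (simp add: dist_norm)
  moreover have "0 \<le> i \<bullet> normal_dir"
    using inner_Basis[OF i(1) normal_dir_Basis] by simp
  then have "x + d *\<^sub>R i \<in> half_space"
    using S(2) T(2) d(1) by (simp add: half_space_def inner_add_left)
  ultimately show "\<exists>d. 0 < \<bar>d\<bar> \<and> \<bar>d\<bar> < e \<and> x + d *\<^sub>R i \<in> S"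
    using d r(2) T(2) by (intro exI[of _ d]) auto
qed

text \<open>Linearity in \<open>v\<close> compares chosen derivatives of different functions, so it
  rests on uniqueness of the derivative within \<open>S\<close>. It is needed for the bilinearity of
  the exterior derivative at a point.\<close>

lemma linear_frechet_derivative_coefficients:
  fixes \<beta> :: "'m::euclidean_space \<Rightarrow> 'm \<Rightarrow> real"
  assumes "x \<in> S"
    and unique: "\<And>(f :: 'm \<Rightarrow> real) D D'. (f has_derivative D) (at x within S) \<Longrightarrow>
      (f has_derivative D') (at x within S) \<Longrightarrow> D = D'"
    and lin: "\<And>y. y \<in> S \<Longrightarrow> linear (\<beta> y)"
    and diff: "\<And>v. (\<lambda>y. \<beta> y v) differentiable (at x within S)"
  shows "linear (\<lambda>v. frechet_derivative (\<lambda>y. \<beta> y v) (at x within S) u)"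
proof -
  let ?D = "\<lambda>v. frechet_derivative (\<lambda>y. \<beta> y v) (at x within S)"
  have D: "((\<lambda>y. \<beta> y v) has_derivative ?D v) (at x within S)" for v
    using diff by (simp add: frechet_derivative_works)
  have "?D (v + w) = (\<lambda>u. ?D v u + ?D w u)" for v w
  proof (rule unique[OF D])
    show "((\<lambda>y. \<beta> y (v + w)) has_derivative (\<lambda>u. ?D v u + ?D w u)) (at x within S)"
      by (rule has_derivative_transform[OF \<open>x \<in> S\<close> _ has_derivative_add[OF D D]])
        (simp add: linear_add[OF lin])
  qed
  moreover have "?D (c *\<^sub>R v) = (\<lambda>u. c * ?D v u)" for c v
  proof (rule unique[OF D])
    show "((\<lambda>y. \<beta> y (c *\<^sub>R v)) has_derivative (\<lambda>u. c * ?D v u)) (at x within S)"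
      by (rule has_derivative_transform[OF \<open>x \<in> S\<close> _ has_derivative_mult_right[OF D]])
        (simp add: linear_cmul[OF lin])
  qed
  ultimately show ?thesis by (intro linearI) simp_all
qed

text \<open>The map from \<open>(w, c)\<close> to \<open>l w + c *\<^sub>R X\<close> is an
  isomorphism onto the hyperplane: \<open>D\<close> recovers \<open>w\<close>, and then
  \<open>X \<noteq> 0\<close> recovers \<open>c\<close>. The normal direction adds the second
  dimension.\<close>

lemma dim_reduction:
  fixes l :: "'r::euclidean_space \<Rightarrow> 'm::euclidean_space" and D :: "'m \<Rightarrow> 'r"
  assumes l: "linear l" "\<And>w. l w \<in> bdry_hyperplane" "\<And>w. D (l w) = w"
    and X: "X \<in> bdry_hyperplane" "D X = 0" "X \<noteq> 0" and D: "linear D"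
    and H: "\<And>h. h \<in> bdry_hyperplane \<Longrightarrow> \<exists>c. h = l (D h) + c *\<^sub>R X"
  shows "DIM('m) = DIM('r) + 2"
proof -
  define L where "L = (\<lambda>u :: 'r \<times> real. l (fst u) + snd u *\<^sub>R X)"
  have lin: "linear L"
    by (rule linearI) (simp_all add: L_def linear_add[OF l(1)] linear_cmul[OF l(1)] algebra_simps)
  have "inj L"
    unfolding linear_injective_0[OF lin]
  proof (intro allI impI)
    fix u assume u: "L u = 0"
    then have "D (L u) = 0" by (simp add: linear_0[OF D])
    then have "fst u = 0" using l(3) X(2) by (simp add: L_def linear_add[OF D] linear_cmul[OF D])
    moreover from this u have "snd u = 0" using X(3) by (simp add: L_def linear_0[OF l(1)])
    ultimately show "u = 0" by (simp add: prod_eq_iff)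
  qed
  then have "dim (range L) = DIM('r) + 1"
    using dim_image_eq[OF lin, of UNIV] by simp
  moreover have "range L = bdry_hyperplane"
  proof safe
    show "L u \<in> bdry_hyperplane" for u
      unfolding L_def using l(2) X(1) by (intro subspace_add subspace_scale subspace_bdry_hyperplane)
    show "h \<in> range L" if "h \<in> bdry_hyperplane" for h
    proof -
      obtain c where "h = l (D h) + c *\<^sub>R X" using H[OF \<open>h \<in> bdry_hyperplane\<close>] by blast
      then have "h = L (D h, c)" by (simp add: L_def)
      then show ?thesis by blast
    qed
  qed
  moreover have "dim (bdry_hyperplane :: 'm set) = DIM('m) - 1"
    using dim_hyperplane[of "normal_dir :: 'm"] nonzero_Basis[OF normal_dir_Basis[where 'm = 'm]]
    by (simp add: bdry_hyperplane_def inner_commute)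
  ultimately have "DIM('m) - 1 = DIM('r) + 1" by simp
  then show ?thesis by simp
qed

section \<open>One-forms and their reduction in charts\<close>

lemma one_formD:
  assumes "one_form M \<beta>" "(U, \<phi>) \<in> atlas M"
  shows "x \<in> \<phi> ` U \<Longrightarrow> linear (\<beta> (U, \<phi>) x)" and "smooth_on (\<phi> ` U) (\<lambda>x. \<beta> (U, \<phi>) x v)"
proof -
  note * = bspec[OF assms(1)[unfolded one_form_def] assms(2), unfolded case_prod_conv]
  show "linear (\<beta> (U, \<phi>) x)" if "x \<in> \<phi> ` U"
    by (rule bspec[OF conjunct1[OF *] that])
  show "smooth_on (\<phi> ` U) (\<lambda>x. \<beta> (U, \<phi>) x v)"
    by (rule spec[OF conjunct1[OF conjunct2[OF *]]])
qed

lemma contact_wedge_in_chart: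
  "wedge 1 (2 * n) (\<lambda>v. \<beta> (U, \<phi>) x (v 0)) (wedge_power (ext_deriv \<beta> (U, \<phi>) x) n) v =
    1 / 2 ^ n * contact_sum n (\<beta> (U, \<phi>) x)
      (\<lambda>a b. frechet_derivative (\<lambda>y. \<beta> (U, \<phi>) y b) (at x within \<phi> ` U) a -
             frechet_derivative (\<lambda>y. \<beta> (U, \<phi>) y a) (at x within \<phi> ` U) b) v"
  unfolding ext_deriv_def case_prod_conv by (rule contact_wedge_eq_sum)

text \<open>Both pullbacks are evaluated along the line through \<open>\<phi> q\<close> in direction
  \<open>h\<close>, which stays in the boundary chart near \<open>\<phi> q\<close>. The inclusion
  turns its velocity into \<open>h\<close>, the projection into the derivative of \<open>G\<close>
  in direction \<open>h\<close>, so the agreement of forms becomes an identity free of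
  choices.\<close>

lemma reduced_form_in_charts:
  fixes M :: "('p, 'm::euclidean_space) mfld" and B :: "('q, 'r::euclidean_space) mfld"
  assumes M: "smooth_atlas half_space M" and B: "smooth_atlas UNIV B"
    and \<beta>: "one_form M \<beta>" and \<gamma>: "one_form B \<gamma>" and \<pi>: "smooth_map (bdry M) B \<pi>"
    and agree: "forms_agree bdry_hyperplane (bdry M) (pullback B \<pi> \<gamma>) (restr_to_bdry M \<beta>)"
    and U: "(U, \<phi>) \<in> atlas M" "q \<in> U" "q \<in> bdry_points M"
    and V: "(V, \<xi>) \<in> atlas B" "\<pi> q \<in> V"
    and W: "open W" "\<phi> q \<in> W" "\<forall>k. C_k_on k W G"
    and G: "\<And>q. q \<in> U \<Longrightarrow> q \<in> bdry_points M \<Longrightarrow> \<pi> q \<in> V \<Longrightarrow> \<phi> q \<in> W \<Longrightarrow> G (\<phi> q) = \<xi> (\<pi> q)"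
    and h: "h \<in> bdry_hyperplane"
  shows "\<beta> (U, \<phi>) (\<phi> q) h = \<gamma> (V, \<xi>) (G (\<phi> q)) (frechet_derivative G (at (\<phi> q)) h)"
proof -
  let ?P = "bdry M" and ?U = "U \<inter> bdry_points M"
  have P: "smooth_atlas bdry_hyperplane ?P" by (rule smooth_atlas_bdry[OF M])
  have U': "(?U, \<phi>) \<in> atlas ?P" by (rule atlas_bdry[OF U(1)])
  have q: "q \<in> ?U" using U by simp
  note injU = smooth_atlasD(4)[OF P U']
  let ?c = "\<lambda>t. \<phi> q + t *\<^sub>R h"
  have c: "(?c has_vector_derivative h) (at 0)" "?c 0 = \<phi> q"
    by (simp_all add: has_vector_derivative_line)
  have ev: "\<forall>\<^sub>F t in nhds 0. ?c t \<in> \<phi> ` (?U \<inter> f -` A)"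
    if f: "continuous_map (mspace ?P) Y f" "openin Y A" "f q \<in> A" for f :: "'p \<Rightarrow> 'x" and Y A
  proof (rule eventually_line_in_bdry_chart[OF chart_preimage_open[OF P U' f(1,2)] _ h])
    show "\<phi> q \<in> \<phi> ` (?U \<inter> f -` A)" using q f(3) by blast
  qed
  have id_cont: "continuous_map (mspace ?P) (mspace M) id"
    by (simp add: bdry_def submfld_def continuous_map_from_subtopology)
  have "\<forall>\<^sub>F t in nhds 0. ?c t \<in> W"
    by (rule eventually_nhds_continuous_openin[of UNIV]) (use W in auto)
  then have G_ev: "\<forall>\<^sub>F t in nhds 0. G (?c t) = \<xi> (\<pi> (inv_into ?U \<phi> (?c t)))"
    using ev[OF smooth_mapD(1)[OF \<pi>] smooth_atlasD(1)[OF B V(1)] V(2)]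
  proof eventually_elim
    case (elim t)
    then obtain q' where q': "q' \<in> ?U" "\<pi> q' \<in> V" "?c t = \<phi> q'" by auto
    then show ?case using G[of q'] elim(1) inv_into_f_f[OF injU q'(1)] by simp
  qed
  have G_der: "((\<lambda>t. G (?c t)) has_vector_derivative frechet_derivative G (at (\<phi> q)) h) (at 0)"
    by (rule has_vector_derivative_frechet_line)
      (use C_k_on_all_has_derivative[OF W(3,2)] in \<open>auto simp: differentiable_def\<close>)
  have d: "((\<lambda>t. \<xi> (\<pi> (inv_into ?U \<phi> (?c t)))) has_vector_derivative
      frechet_derivative G (at (\<phi> q)) h) (at 0)"
    by (rule has_vector_derivative_cong_eventually[OF G_der G_ev])
  have "pullback B \<pi> \<gamma> (?U, \<phi>) (\<phi> q) h = \<gamma> (V, \<xi>) (\<xi> (\<pi> q)) (frechet_derivative G (at (\<phi> q)) h)"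
    by (rule pullback_eq_along_curve[OF B \<gamma> injU q smooth_mapD(2)[OF \<pi> U'] c
          ev[OF smooth_mapD(1)[OF \<pi>]] V d])
  moreover have "pullback M id \<beta> (?U, \<phi>) (\<phi> q) h = \<beta> (U, \<phi>) (\<phi> (id q)) h"
  proof (rule pullback_eq_along_curve[OF M \<beta> injU q _ c ev[OF id_cont] U(1)])
    show "id q \<in> U" using U(2) by simp
    have "\<forall>\<^sub>F t in nhds 0. ?c t = \<phi> (id (inv_into ?U \<phi> (?c t)))"
      using ev[OF id_cont smooth_atlasD(1)[OF M U(1)] \<open>id q \<in> U\<close>]
    proof eventually_elim
      case (elim t)
      then show ?case using f_inv_into_f[of "?c t" \<phi> ?U] by auto
    qed
    then show "((\<lambda>t. \<phi> (id (inv_into ?U \<phi> (?c t)))) has_vector_derivative h) (at 0)"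
      by (rule has_vector_derivative_cong_eventually[OF c(1)])
    show "smooth_on (\<phi> ` (?U \<inter> id -` V')) (\<psi>' \<circ> id \<circ> inv_into ?U \<phi>)"
      if V': "(V', \<psi>') \<in> atlas M" for V' \<psi>'
    proof (rule smooth_on_cong[OF smooth_on_subset[OF smooth_atlasD(5)[OF M U(1) V']]])
      fix x assume "x \<in> \<phi> ` (?U \<inter> id -` V')"
      then have "inv_into ?U \<phi> x = inv_into U \<phi> x"
        by (intro inv_into_subset_eq[OF smooth_atlasD(4)[OF M U(1)]]) auto
      then show "(\<psi>' \<circ> inv_into U \<phi>) x = (\<psi>' \<circ> id \<circ> inv_into ?U \<phi>) x" by simp
    qed auto
  qed
  moreover have "pullback B \<pi> \<gamma> (?U, \<phi>) (\<phi> q) h = pullback M id \<beta> (?U, \<phi>) (\<phi> q) h"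
    using bspec[OF bspec[OF bspec[OF agree[unfolded forms_agree_def] U', unfolded case_prod_conv]
          imageI[OF q]] h]
    unfolding restr_to_bdry_def .
  ultimately show ?thesis using G[OF U(2,3) V(2) W(2)] by simp
qed

theorem lemma10p3:
  fixes M :: "('p, 'm::euclidean_space) mfld"
    and Mred :: "('p set, 'r::euclidean_space) mfld"
    and U :: "'p set"
    and act :: "complex \<Rightarrow> 'p \<Rightarrow> 'p"
    and \<beta> :: "('p, 'm) form1"
    and \<beta>red :: "('p set, 'r) form1"
    and n :: nat
  assumes "manifold_with_boundary M"
    and "free_circle_action_near_boundary M U act"
    and "is_reduced_space M act Mred"
    and "contact_one_form n M \<beta>"
    and "basic_on_boundary M act \<beta>"
    and "invariant_near_boundary M U act \<beta>"
    and "is_reduced_form M act Mred \<beta> \<beta>red"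
  shows "contact_one_form (n - 1) Mred \<beta>red"
proof -
  let ?\<pi> = "orbit act" and ?H = "bdry_hyperplane :: 'm set"
  have M: "smooth_atlas half_space M" using assms(1) by (simp add: manifold_with_boundary_def)
  have B: "smooth_atlas UNIV Mred" and pts: "points Mred = ?\<pi> ` bdry_points M"
    and princ: "principal_circle_bundle (bdry M) act Mred ?\<pi>"
    using assms(3) by (simp_all add: is_reduced_space_def manifold_def)
  have \<pi>: "smooth_map (bdry M) Mred ?\<pi>" using princ by (simp add: principal_circle_bundle_def)
  have \<beta>: "one_form M \<beta>" and dimM: "has_dim M (2 * n + 1)"
    and contact: "\<forall>(U, \<phi>)\<in>atlas M. \<forall>x\<in>\<phi> ` U.
        wedge 1 (2 * n) (\<lambda>v. \<beta> (U, \<phi>) x (v 0)) (wedge_power (ext_deriv \<beta> (U, \<phi>) x) n) \<noteq> (\<lambda>v. 0)"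
    using assms(4) by (simp_all add: contact_one_form_def)
  have \<gamma>: "one_form Mred \<beta>red"
    and agree: "forms_agree ?H (bdry M) (pullback Mred ?\<pi> \<beta>red) (restr_to_bdry M \<beta>)"
    using assms(7) by (simp_all add: is_reduced_form_def)
  \<comment> \<open>The dimension is proved together with nonvanishing because the argument for it
    starts from a boundary point over \<open>y\<close>.\<close>
  have point: "DIM('r) = 2 * (n - 1) + 1 \<and>
      wedge 1 (2 * (n - 1)) (\<lambda>v. \<beta>red (V, \<xi>) y (v 0)) (wedge_power (ext_deriv \<beta>red (V, \<xi>) y) (n - 1)) \<noteq> (\<lambda>v. 0)"
    if V: "(V, \<xi>) \<in> atlas Mred" and y: "y \<in> \<xi> ` V" for V \<xi> y
  proof -
    obtain b where b: "b \<in> V" "y = \<xi> b" using y by blast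
    then have "b \<in> points Mred" using openin_subset[OF smooth_atlasD(1)[OF B V]] by blast
    then obtain p where p: "p \<in> bdry_points M" "b = ?\<pi> p" using pts by blast
    obtain C \<phi> where C: "(C, \<phi>) \<in> atlas M" "p \<in> C" by (use p(1) in \<open>auto simp: bdry_points_def\<close>)
    have pV: "?\<pi> p \<in> V" using b p by simp
    obtain G W and l :: "'r \<Rightarrow> 'm" and X where W: "open W" "\<phi> p \<in> W" "\<forall>k. C_k_on k W G"
      and G: "\<And>q. q \<in> C \<Longrightarrow> q \<in> bdry_points M \<Longrightarrow> ?\<pi> q \<in> V \<Longrightarrow> \<phi> q \<in> W \<Longrightarrow> G (\<phi> q) = \<xi> (?\<pi> q)"
      and l: "linear l" "\<And>w. l w \<in> ?H" "\<And>w. frechet_derivative G (at (\<phi> p)) (l w) = w"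
      and X: "X \<in> ?H" "frechet_derivative G (at (\<phi> p)) X = 0" "X \<noteq> 0"
      and H: "\<And>h. h \<in> ?H \<Longrightarrow> \<exists>c. h = l (frechet_derivative G (at (\<phi> p)) h) + c *\<^sub>R X"
      using reduction_chart[OF M B princ C p(1) V pV] by metis
    define D where "D = frechet_derivative G (at (\<phi> p))"
    note l = l[folded D_def] and X = X[folded D_def] and H = H[folded D_def]
    let ?S = "\<phi> ` C" and ?x = "\<phi> p"
    have Gx: "G ?x = y" using G[OF C(2) p(1) pV W(2)] b p by simp
    have xS: "?x \<in> ?S" using C(2) by blast
    have linD: "linear D"
      unfolding D_def using C_k_on_all_has_derivative[OF W(3,2)] has_derivative_linear by blast
    have "points M \<noteq> {}" using p(1) bdry_points_subset[OF M] by blast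
    then have "DIM('m) = 2 * n + 1" using dimM by (simp add: has_dim_def)
    moreover have "DIM('m) = DIM('r) + 2" by (rule dim_reduction[OF l X linD H])
    moreover have "0 < DIM('r)" by simp
    \<comment> \<open>\<open>2 * n + 1 = DIM('r) + 2\<close> with \<open>DIM('r)\<close> positive
      excludes \<open>n = 0\<close>, so \<open>n - 1\<close> is a genuine predecessor.\<close>
    ultimately obtain m where m: "n = Suc m" and dimr: "DIM('r) = 2 * m + 1"
      by (cases n) auto
    define w where "w = (\<lambda>a b. frechet_derivative (\<lambda>y. \<beta> (C, \<phi>) y b) (at ?x within ?S) a -
             frechet_derivative (\<lambda>y. \<beta> (C, \<phi>) y a) (at ?x within ?S) b)"
    define wr where "wr = (\<lambda>a b. frechet_derivative (\<lambda>u. \<beta>red (V, \<xi>) u b) (at y within \<xi> ` V) a -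
             frechet_derivative (\<lambda>u. \<beta>red (V, \<xi>) u a) (at y within \<xi> ` V) b)"
    have S: "openin (top_of_set half_space) ?S" by (rule smooth_atlasD(2)[OF M C(1)])
    have diff: "(\<lambda>u. \<beta> (C, \<phi>) u v) differentiable (at ?x within ?S)" for v
      by (rule smooth_on_differentiable_within[OF one_formD(2)[OF \<beta> C(1)] xS])
    have R: "open (\<xi> ` V)" using smooth_atlasD(2)[OF B V] by simp
    have diffr: "(\<lambda>u. \<beta>red (V, \<xi>) u v) differentiable (at y)" for v
      using smooth_on_differentiable_within[OF one_formD(2)[OF \<gamma> V] y] at_within_open[OF y R] by simp
    have lin1: "linear (\<lambda>v. frechet_derivative (\<lambda>u. \<beta> (C, \<phi>) u v) (at ?x within ?S) a)" for a
      by (rule linear_frechet_derivative_coefficients[OF xS half_space_has_derivative_unique[OF S xS]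
          one_formD(1)[OF \<beta> C(1)] diff])
    have lin2: "linear (frechet_derivative (\<lambda>u. \<beta> (C, \<phi>) u v) (at ?x within ?S))" for v
      using diff frechet_derivative_works has_derivative_linear by blast
    \<comment> \<open>These are the boundary points of the chart at which \<open>G\<close>
      represents the projection; there \<open>\<beta>\<close> is a pullback on hyperplane
      vectors.\<close>
    define Q where "Q = {u. \<exists>q. q \<in> C \<and> q \<in> bdry_points M \<and> ?\<pi> q \<in> V \<and> u = \<phi> q \<and> u \<in> W}"
    have Q_eq: "\<beta> (C, \<phi>) u h = \<beta>red (V, \<xi>) (G u) (frechet_derivative G (at u) h)"
      if "u \<in> Q" "h \<in> ?H" for u h
    proof -
      obtain q where q: "q \<in> C" "q \<in> bdry_points M" "?\<pi> q \<in> V" "u = \<phi> q" "\<phi> q \<in> W"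
        using \<open>u \<in> Q\<close> by (auto simp: Q_def)
      show ?thesis
        unfolding q(4)
        by (rule reduced_form_in_charts[OF M B \<beta> \<gamma> \<pi> agree C(1) q(1,2) V q(3) W(1) q(5) W(3) G that(2)])
    qed
    have Q_ev: "\<forall>\<^sub>F t in nhds 0. ?x + t *\<^sub>R h \<in> ?S \<inter> Q" if h: "h \<in> ?H" for h
    proof -
      note P = smooth_atlas_bdry[OF M] and C' = atlas_bdry[OF C(1)]
      have "?x \<in> \<phi> ` (C \<inter> bdry_points M \<inter> ?\<pi> -` V)" using C(2) p(1) pV by blast
      from eventually_line_in_bdry_chart[OF chart_preimage_open[OF P C' smooth_mapD(1)[OF \<pi>]
          smooth_atlasD(1)[OF B V]] this h]
      have "\<forall>\<^sub>F t in nhds 0. ?x + t *\<^sub>R h \<in> \<phi> ` (C \<inter> bdry_points M \<inter> ?\<pi> -` V)" .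
      moreover have "\<forall>\<^sub>F t in nhds 0. ?x + t *\<^sub>R h \<in> W"
        by (rule eventually_nhds_continuous_openin[of UNIV]) (use W in auto)
      ultimately show ?thesis by eventually_elim (auto simp: Q_def)
    qed
    have xQ: "?x \<in> Q" using C(2) p(1) pV W(2) by (auto simp: Q_def)
    have w_eq: "w h1 h2 = wr (D h1) (D h2)" if "h1 \<in> ?H" "h2 \<in> ?H" for h1 h2
      using ext_deriv_pullback[where \<beta> = "\<beta> (C, \<phi>)" and \<rho> = "\<beta>red (V, \<xi>)" and S = ?S and H = ?H and Q = Q,
          OF W(3,1,2) R _ one_formD(1)[OF \<gamma> V] diff _ Q_ev Q_eq that]
        diffr y at_within_open[OF y R]
      by (simp add: w_def wr_def D_def Gx)
    have "wedge 1 (2 * n) (\<lambda>v. \<beta> (C, \<phi>) ?x (v 0)) (wedge_power (ext_deriv \<beta> (C, \<phi>) ?x) n) \<noteq> (\<lambda>v. 0)"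
      using bspec[OF contact C(1), unfolded case_prod_conv] xS by blast
    then obtain v where v: "contact_sum (Suc m) (\<beta> (C, \<phi>) ?x) w v \<noteq> 0"
      unfolding fun_eq_iff contact_wedge_in_chart w_def m by auto
    have "\<exists>u. contact_sum m (\<beta>red (V, \<xi>) y) wr u \<noteq> 0"
    proof (rule contact_sum_reduction[where H = ?H and D = D, OF dimr])
      show "linear (\<beta> (C, \<phi>) ?x)" by (rule one_formD(1)[OF \<beta> C(1) xS])
      show "linear (w u)" for u
        unfolding w_def by (intro linear_compose_sub lin1 lin2)
      show "linear (\<lambda>x. w x u)" for u
        unfolding w_def by (intro linear_compose_sub lin1 lin2)
      show "w b a = - w a b" for a b by (simp add: w_def)
      show "linear (\<beta>red (V, \<xi>) y)" by (rule one_formD(1)[OF \<gamma> V y])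
      show "linear (wr u)" for u
        unfolding wr_def
      proof (rule linear_compose_sub)
        show "linear (frechet_derivative (\<lambda>a. \<beta>red (V, \<xi>) a u) (at y within \<xi> ` V))"
          using diffr frechet_derivative_works has_derivative_linear at_within_open[OF y R] by metis
        show "linear (\<lambda>v. frechet_derivative (\<lambda>a. \<beta>red (V, \<xi>) a v) (at y within \<xi> ` V) u)"
          by (rule linear_frechet_derivative_coefficients[OF y _ one_formD(1)[OF \<gamma> V]])
            (use diffr has_derivative_unique in \<open>auto simp: at_within_open[OF y R]\<close>)
      qed
      \<comment> \<open>This instantiates the transverse vector \<open>N\<close> by
        \<open>normal_dir\<close>; \<open>c\<close> is the normal component of
        \<open>x\<close>.\<close>
      show "\<exists>c. x - c *\<^sub>R normal_dir \<in> ?H" for x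
        using inner_same_Basis[OF normal_dir_Basis[where 'm = 'm]]
        by (intro exI[of _ "x \<bullet> normal_dir"]) (simp add: bdry_hyperplane_def inner_diff_left)
      show "\<beta> (C, \<phi>) ?x h = \<beta>red (V, \<xi>) y (D h)" if "h \<in> ?H" for h
        using Q_eq[OF xQ that] by (simp add: Gx D_def)
    qed (fact l X(1,2) H w_eq v)+
    then have "wedge 1 (2 * m) (\<lambda>v. \<beta>red (V, \<xi>) y (v 0)) (wedge_power (ext_deriv \<beta>red (V, \<xi>) y) m) \<noteq> (\<lambda>v. 0)"
      unfolding fun_eq_iff contact_wedge_in_chart wr_def by auto
    then show ?thesis using dimr by (simp add: m)
  qed
  \<comment> \<open>An empty reduced space has every dimension; by the dimension count in
    \<open>point\<close>, this is the only case in which \<open>n = 0\<close> can occur.\<close>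
  have "has_dim Mred (2 * (n - 1) + 1)"
    unfolding has_dim_def
  proof
    assume "points Mred \<noteq> {}"
    moreover have "points Mred = (\<Union>(U, \<phi>)\<in>atlas Mred. U)" using B by (simp add: smooth_atlas_def)
    ultimately obtain V \<xi> b where "(V, \<xi>) \<in> atlas Mred" "b \<in> V" by auto
    then show "DIM('r) = 2 * (n - 1) + 1" using point by blast
  qed
  then show ?thesis
    unfolding contact_one_form_def using \<gamma> point by (intro conjI) auto
qed

end
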